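(* Let $L$ be a (full-rank) sublattice of $\mathbb{H}$ and let $B\in\mathbb{N}$ be the positive integer such that $B\mathbb{Z}=[\mathbb{H}:L](\mathfrak{n}L)^{-1}$. Then \[ \zeta_L^{\mathrm{SL}}(s) =\frac{\zeta(s-1)}{\zeta(s)} \sum_{b \mid B} (B/b)^{-s}\sum_{m=1}^{\infty} \frac{ \# \{d^2 \bmod b \;:\; d \mid m,\ \gcd(d,b)=1 \} }{m^s}, \] where $b$ runs over positive divisors of $B$ and, in the inner set, $d$ runs over positive divisors of $m$.
   Context: $\mathbb{H}=\mathbb{Z}e_1+\mathbb{Z}e_2$ is the free rank-2 $\mathbb{Z}$-module with quadratic form $Q$ and symmetric bilinear form $B(x,y)=\frac12(Q(x+y)-Q(x)-Q(y))$ given by $Q(e_1)=Q(e_2)=0$, $B(e_1,e_2)=\frac12$ (so $Q(xe_1+ye_2)=xy$). A sublattice means a subgroup of rank 2 (finite index), with the restricted form. The norm ideal $\mathfrak{n}L$ is the ideal of $\mathbb{Z}$ generated by all $Q(x)$, $x\in L$; $[\mathbb{H}:L]$ is the index; $[\mathbb{H}:L](\mathfrak{n}L)^{-1}$ is a product of fractional ideals of $\mathbb{Z}$, and it is of the form $B\mathbb{Z}$ with $B\in\mathbb{N}$. Let $V=\mathbb{Q}L$. $O(V)=\{\sigma\in\mathrm{GL}(V): B(\sigma x,\sigma y)=B(x,y)\ \forall x,y\in V\}$ and $O^+(V)=O(V)\cap \mathrm{SL}(V)$. Two lattices $K_1,K_2$ in $V$ are properly isometric if $\sigma(K_1)=K_2$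 for some $\sigma\in O^+(V)$. For $m\in\mathbb{N}$, $a_m^+(L)$ is the number of proper isometry classes among the sublattices $K\subseteq L$ with $[L:K]=m$, and $\zeta_L^{\mathrm{SL}}(s)=\sum_{m\ge1}a_m^+(L)m^{-s}$. $\zeta(s)$ is the Riemann zeta function. The identity is an identity of Dirichlet series (for $\Re(s)>2$). *)

theory Defs
  imports "HOL-Analysis.Analysis" "HOL-Algebra.Coset"
begin

text \<open>
  The hyperbolic plane is realised inside \<open>V = \<rat>\<^sup>2\<close>, with \<open>e\<^sub>1, e\<^sub>2\<close> the standard basis
  \<^term>\<open>axis 1 1\<close>, \<^term>\<open>axis 2 1\<close>. A sublattice \<open>L\<close> of it has full rank, so \<open>\<rat>L\<close> is all of \<open>V\<close>.
\<close>

definition Qform :: "rat ^ 2 \<Rightarrow> rat"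
  where "Qform x = x $ 1 * x $ 2"

definition Bform :: "rat ^ 2 \<Rightarrow> rat ^ 2 \<Rightarrow> rat"
  where "Bform x y = (Qform (x + y) - Qform x - Qform y) / 2"

definition hyperbolic :: "(rat ^ 2) set"
  where "hyperbolic = {x. \<forall>i. x $ i \<in> \<int>}"

definition add_group :: "(rat ^ 2) set \<Rightarrow> (rat ^ 2) monoid"
  where "add_group M = \<lparr>carrier = M, mult = (+), one = 0\<rparr>"

definition sublattice :: "(rat ^ 2) set \<Rightarrow> (rat ^ 2) set \<Rightarrow> bool"
  where "sublattice K M \<longleftrightarrow> subgroup K (add_group M) \<and> finite (rcosets\<^bsub>add_group M\<^esub> K)"

definition lattice_index :: "(rat ^ 2) set \<Rightarrow> (rat ^ 2) set \<Rightarrow> nat"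
  where "lattice_index M K = card (rcosets\<^bsub>add_group M\<^esub> K)"

text \<open>The ideals of \<open>\<int>\<close> below are taken as fractional ideals, i.e. as subsets of \<open>\<rat>\<close>.\<close>

definition norm_ideal :: "(rat ^ 2) set \<Rightarrow> rat set"
  where "norm_ideal L = module.span (\<lambda>(k::int) q. of_int k * q) (Qform ` L)"

definition frac_ideal_inverse :: "rat set \<Rightarrow> rat set"
  where "frac_ideal_inverse I = {q. \<forall>x\<in>I. q * x \<in> \<int>}"

text \<open>\<open>GL(V)\<close> is identified with the invertible matrices over \<open>\<rat>\<close>, acting by \<^term>\<open>(*v)\<close>.\<close>

definition orthogonal_group :: "(rat ^ 2 ^ 2) set"
  where "orthogonal_group =
    {\<sigma>. invertible \<sigma> \<and> (\<forall>x y. Bform (\<sigma> *v x) (\<sigma> *v y) = Bform x y)}"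

definition proper_orthogonal_group :: "(rat ^ 2 ^ 2) set"
  where "proper_orthogonal_group = {\<sigma> \<in> orthogonal_group. det \<sigma> = 1}"

definition properly_isometric :: "(rat ^ 2) set \<Rightarrow> (rat ^ 2) set \<Rightarrow> bool"
  where "properly_isometric K\<^sub>1 K\<^sub>2 \<longleftrightarrow> (\<exists>\<sigma>\<in>proper_orthogonal_group. (*v) \<sigma> ` K\<^sub>1 = K\<^sub>2)"

definition sublattices_of_index :: "(rat ^ 2) set \<Rightarrow> nat \<Rightarrow> (rat ^ 2) set set"
  where "sublattices_of_index L m = {K. sublattice K L \<and> lattice_index L K = m}"

definition num_proper_classes :: "(rat ^ 2) set \<Rightarrow> nat \<Rightarrow> nat"
  where "num_proper_classes L m =
    card (sublattices_of_index L m //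
      {(K\<^sub>1, K\<^sub>2). K\<^sub>1 \<in> sublattices_of_index L m \<and> K\<^sub>2 \<in> sublattices_of_index L m \<and>
                 properly_isometric K\<^sub>1 K\<^sub>2})"

definition dirichlet_term :: "(nat \<Rightarrow> nat) \<Rightarrow> complex \<Rightarrow> nat \<Rightarrow> complex"
  where "dirichlet_term a s m = of_nat (a m) / of_nat m powr s"

definition dirichlet_series :: "(nat \<Rightarrow> nat) \<Rightarrow> complex \<Rightarrow> complex"
  where "dirichlet_series a s = (\<Sum>\<^sub>\<infinity>m\<in>{1..}. dirichlet_term a s m)"

text \<open>This is the Riemann zeta function only on the half-plane \<open>Re s > 1\<close>.\<close>

definition riemann_zeta :: "complex \<Rightarrow> complex"
  where "riemann_zeta s = dirichlet_series (\<lambda>_. 1) s"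

definition zeta_SL :: "(rat ^ 2) set \<Rightarrow> complex \<Rightarrow> complex"
  where "zeta_SL L s = dirichlet_series (num_proper_classes L) s"

definition num_square_residues :: "nat \<Rightarrow> nat \<Rightarrow> nat"
  where "num_square_residues b m = card {d\<^sup>2 mod b | d. d dvd m \<and> coprime d b}"

end

theory Submission
  imports Defs "HOL-Number_Theory.Totient"
begin

text \<open>
  Everything takes place in coordinates. The group \<open>O\<^sup>+(V)\<close> consists of the maps
  \<open>(x, y) \<mapsto> (t x, y / t)\<close> with \<open>t \<noteq> 0\<close>, because a map preserving \<open>x y\<close> permutes the two isotropic
  lines and determinant one forbids the exchange. Every lattice has a normal form \<open>lat a c d\<close>,
  spanned by \<open>(a, 0)\<close> and \<open>(c, d)\<close> with \<open>a, d > 0\<close>, in which \<open>a\<close>, \<open>d\<close> and \<open>c\<close> modulo \<open>a\<close>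
  are unique. So a proper isometry class is the same thing as a pair consisting of
  the covolume \<open>a d\<close> and the slope \<open>c / a\<close> in \<open>\<rat>/\<int>\<close>. For \<open>L = lat a c d\<close> of slope \<open>\<theta>\<close> the norm ideal
  is generated by \<open>a d\<close> and \<open>a d \<theta>\<close>, hence \<open>B\<close> is the order of \<open>\<theta>\<close> in \<open>\<rat>/\<int>\<close>; and the sublattices
  of index \<open>m\<close> realise exactly the slopes \<open>x\<close> with \<open>a x = d \<theta>\<close> in \<open>\<rat>/\<int>\<close> for some factorisation
  \<open>m = a d\<close>. The coefficient of \<open>m\<^sup>-\<^sup>s\<close> on the left is therefore the number of such \<open>x\<close>
  (\<open>num_proper_classes_lat\<close>, \<open>order_mod_Ints_from_norm_ideal\<close>).

  To count them, sort the \<open>x\<close> by the order \<open>b\<close> of the common value \<open>a x = d \<theta>\<close>. If \<open>x\<close> has order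
  \<open>N\<close>, then \<open>b\<^sup>2 gcd(B N, m) = B N\<close>, so \<open>b\<close> depends on \<open>x\<close> alone and not on the factorisation chosen.
  Order \<open>b\<close> means \<open>gcd(B, d) = B / b\<close>; cancelling this factor from \<open>m\<close> and \<open>d\<close> and absorbing it in \<open>\<theta>\<close>
  reduces the problem to \<open>\<tau>\<close> of order \<open>b\<close>, to \<open>M = m / (B / b)\<close>, and to factorisations \<open>M = a d\<close> with \<open>d\<close>
  prime to \<open>b\<close> (\<open>slopes_decomposition\<close>, \<open>slopes_disjoint\<close>).

  Write \<open>M = M0 M1\<close> with \<open>M1\<close> prime to \<open>b\<close> and \<open>M0\<close> composed of primes dividing \<open>b\<close>. All of \<open>M0\<close> goes into
  \<open>a\<close>, and multiplication by \<open>M0\<close> is \<open>M0\<close>-to-one on \<open>\<rat>/\<int>\<close>, so \<open>M0\<close> splits off as a factor of the count.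
  For \<open>M1\<close> the order of \<open>x\<close> is \<open>b n\<close> with \<open>n\<close> dividing \<open>M1\<close>. By the Chinese remainder theorem
  \<open>x\<close> is then an element of order \<open>n\<close> together with a unit \<open>u\<close> modulo \<open>b\<close>; with \<open>M1 / n = a' d\<close>
  the condition on \<open>u\<close> is \<open>u = d / a' = d\<^sup>2 / (M1 / n)\<close> modulo \<open>b\<close> up to a fixed unit, and this is where the squares
  come from. Summing over \<open>n\<close> gives \<open>\<Sum> \<phi>(n) N\<^sub>b(M1 / n)\<close>, where \<open>N\<^sub>b\<close> is \<open>num_square_residues b\<close>; since
  \<open>N\<^sub>b\<close> ignores primes dividing \<open>b\<close> and \<open>\<Sum> \<phi>(n) = M0\<close> over \<open>n\<close> dividing \<open>M0\<close>, the factor \<open>M0\<close> turns this into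
  the same sum for \<open>M\<close> (\<open>card_slopes\<close>).

  The count thus is a sum over \<open>b\<close> of Dirichlet convolutions of \<open>\<phi>\<close> with \<open>N\<^sub>b\<close>, shifted by \<open>B / b\<close>,
  and \<open>\<zeta>(s) \<Sum> \<phi>(n) n\<^sup>-\<^sup>s = \<zeta>(s - 1)\<close> finishes the proof (\<open>has_sum_divisor_formula\<close>).
\<close>

section \<open>Orders of rational numbers modulo the integers\<close>

text \<open>
  The order of the class of \<open>x\<close> in \<open>\<rat>/\<int>\<close>, characterised by the subgroup of integers that annihilate it.
\<close>

definition order_mod_Ints :: "rat \<Rightarrow> nat \<Rightarrow> bool" where
  "order_mod_Ints x N \<longleftrightarrow> (\<forall>k::int. of_int k * x \<in> \<int> \<longleftrightarrow> int N dvd k)"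

lemma order_mod_Ints_unique:
  assumes "order_mod_Ints x N" "order_mod_Ints x N'"
  shows "N = N'"
  using assms unfolding order_mod_Ints_def by (metis dvd_antisym dvd_refl of_nat_dvd_iff)

lemma order_mod_Ints_cong:
  assumes "x - y \<in> \<int>"
  shows "order_mod_Ints x N \<longleftrightarrow> order_mod_Ints y N"
proof -
  have "of_int k * x \<in> \<int> \<longleftrightarrow> of_int k * y \<in> \<int>" for k :: int
  proof -
    have "of_int k * x = of_int k * (x - y) + of_int k * y" by (simp add: algebra_simps)
    then show ?thesis using assms by (metis add_in_Ints_iff_left Ints_mult Ints_of_int)
  qed
  then show ?thesis by (simp add: order_mod_Ints_def)
qed

text \<open>
  The order of \<open>a x\<close> is \<open>N / gcd(N, a)\<close>, as in any cyclic group.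
\<close>

lemma order_mod_Ints_mult:
  assumes "order_mod_Ints x N" "N > 0"
  shows "order_mod_Ints (of_nat a * x) (N div gcd N a)"
proof -
  obtain N' a' where d: "N = N' * gcd N a" "a = a' * gcd N a" "coprime N' a'"
    using gcd_coprime_exists[of N a] assms(2) by auto
  define g where "g = gcd N a"
  have d': "N = N' * g" "a = a' * g" using d by (simp_all only: g_def)
  have g0: "g > 0" using assms(2) by (simp add: g_def)
  have "of_int k * (of_nat a * x) \<in> \<int> \<longleftrightarrow> int N' dvd k" for k :: int
  proof -
    have "of_int k * (of_nat a * x) = of_int (k * int a) * x" by simp
    then have "of_int k * (of_nat a * x) \<in> \<int> \<longleftrightarrow> int N dvd k * int a"
      using assms(1) unfolding order_mod_Ints_def by metis
    also have "\<dots> \<longleftrightarrow> int N' dvd k * int a'" using g0 unfolding d' by simp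
    also have "\<dots> \<longleftrightarrow> int N' dvd k" using d(3) by (simp add: coprime_dvd_mult_left_iff)
    finally show ?thesis .
  qed
  moreover have "N div gcd N a = N'" unfolding g_def[symmetric] using d'(1) g0 by simp
  ultimately show ?thesis by (simp add: order_mod_Ints_def)
qed

lemma of_int_divide_in_Ints_iff_rat:
  assumes "n > 0"
  shows "(of_int k / of_nat n :: rat) \<in> \<int> \<longleftrightarrow> int n dvd k"
proof
  assume "(of_int k / of_nat n :: rat) \<in> \<int>"
  then obtain i where "of_int k / of_nat n = (of_int i :: rat)" by (auto elim: Ints_cases)
  then have "of_int k = (of_int (i * int n) :: rat)" using assms by (simp add: field_simps)
  then show "int n dvd k" by (simp only: of_int_eq_iff) simp
next
  assume "int n dvd k"
  then obtain i where "k = int n * i" by (elim dvdE)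
  then show "(of_int k / of_nat n :: rat) \<in> \<int>" using assms by simp
qed

lemma order_mod_Ints_fraction:
  assumes "coprime j N" "N > 0"
  shows "order_mod_Ints (of_nat j / of_nat N) N"
proof -
  have "of_int k * (of_nat j / of_nat N) \<in> (\<int> :: rat set) \<longleftrightarrow> int N dvd k" for k :: int
  proof -
    have "of_int k * (of_nat j / of_nat N) = (of_int (k * int j) / of_nat N :: rat)" by simp
    then have "of_int k * (of_nat j / of_nat N) \<in> (\<int> :: rat set) \<longleftrightarrow> int N dvd k * int j"
      using of_int_divide_in_Ints_iff_rat[OF assms(2)] by metis
    also have "\<dots> \<longleftrightarrow> int N dvd k"
      using assms(1) by (simp add: coprime_dvd_mult_left_iff coprime_commute)
    finally show ?thesis .
  qed
  then show ?thesis by (simp add: order_mod_Ints_def)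
qed

lemma unit_interval_fraction:
  fixes x :: rat
  assumes "0 \<le> x" "x < 1"
  obtains j N where "N > 0" "j < N" "coprime j N" "x = of_nat j / of_nat N"
proof -
  obtain p q where pq: "quotient_of x = (p, q)" by (cases "quotient_of x")
  have q: "q > 0" "coprime p q" "x = of_int p / of_int q"
    using pq by (simp_all add: quotient_of_denom_pos quotient_of_coprime quotient_of_div)
  have p: "p \<ge> 0" "p < q" using assms q by (auto simp: field_simps)
  show thesis
  proof (rule that[of "nat q" "nat p"])
    show "coprime (nat p) (nat q)" using p q by (simp flip: coprime_int_iff)
    show "x = of_nat (nat p) / of_nat (nat q)" using p q by (simp add: of_nat_nat)
  qed (use p q in auto)
qed

text \<open>
  A class of order \<open>b\<close> is \<open>t / b\<close> for a unit \<open>t\<close> modulo \<open>b\<close>, namely its representative in \<open>[0, 1)\<close>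
  in lowest terms.
\<close>

lemma order_mod_Ints_representative:
  assumes "order_mod_Ints x b"
  obtains t where "b > 0" "t < b" "coprime t b" "x - of_nat t / of_nat b \<in> \<int>"
proof -
  obtain t N where t: "N > 0" "t < N" "coprime t N" "frac x = of_nat t / of_nat N"
    using unit_interval_fraction[of "frac x"] frac_ge_0 frac_lt_1 by metis
  have x: "x - of_nat t / of_nat N \<in> \<int>" unfolding t(4)[symmetric] by (simp add: frac_def)
  then have "order_mod_Ints x N" using order_mod_Ints_cong order_mod_Ints_fraction t by blast
  then have "b = N" using assms order_mod_Ints_unique by blast
  then show thesis using that t x by blast
qed

lemma order_mod_Ints_pos: "order_mod_Ints x b \<Longrightarrow> b > 0"
  using order_mod_Ints_representative by blast

lemma order_mod_Ints_exists: "\<exists>N>0. order_mod_Ints x N"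
proof -
  obtain t N where t: "N > 0" "t < N" "coprime t N" "frac x = of_nat t / of_nat N"
    using unit_interval_fraction[of "frac x"] frac_ge_0 frac_lt_1 by metis
  have x: "x - of_nat t / of_nat N \<in> \<int>" unfolding t(4)[symmetric] by (simp add: frac_def)
  then have "order_mod_Ints x N" using order_mod_Ints_cong order_mod_Ints_fraction t by blast
  then show ?thesis using t by blast
qed

section \<open>Lattices in normal form and their sublattices\<close>

text \<open>
  The lattice spanned by \<open>(a, 0)\<close> and \<open>(c, d)\<close>. The shape is the Hermite normal form, with
  the first basis vector on an isotropic line, so that isometries act on \<open>a\<close>, \<open>c\<close>, \<open>d\<close> by scaling.
\<close>

definition lat :: "rat \<Rightarrow> rat \<Rightarrow> rat \<Rightarrow> (rat ^ 2) set" where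
  "lat a c d = {vector [a * of_int x + c * of_int y, d * of_int y] | x y. True}"

lemma vec2_eq_iff: "v = w \<longleftrightarrow> v $ 1 = w $ 1 \<and> v $ 2 = w $ 2" for v w :: "'a ^ 2"
  by (simp add: vec_eq_iff forall_2)

lemma mem_lat_iff:
  "v \<in> lat a c d \<longleftrightarrow> (\<exists>x y. v $ 1 = a * of_int x + c * of_int y \<and> v $ 2 = d * of_int y)"
  by (auto simp: lat_def vec2_eq_iff vector_2)

text \<open>Closure under subtraction encodes being an additive subgroup in a single condition.\<close>

definition add_closed :: "(rat ^ 2) set \<Rightarrow> bool" where
  "add_closed M \<longleftrightarrow> 0 \<in> M \<and> (\<forall>v\<in>M. \<forall>w\<in>M. v - w \<in> M)"

lemma add_closedD:
  assumes "add_closed M"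
  shows "0 \<in> M" "v \<in> M \<Longrightarrow> w \<in> M \<Longrightarrow> v - w \<in> M" "v \<in> M \<Longrightarrow> - v \<in> M"
    "v \<in> M \<Longrightarrow> w \<in> M \<Longrightarrow> v + w \<in> M"
proof -
  show 0: "0 \<in> M" and d: "v \<in> M \<Longrightarrow> w \<in> M \<Longrightarrow> v - w \<in> M" for v w
    using assms by (auto simp: add_closed_def)
  show n: "v \<in> M \<Longrightarrow> - v \<in> M" for v using d[OF 0] by simp
  show "v \<in> M \<Longrightarrow> w \<in> M \<Longrightarrow> v + w \<in> M" using d[OF _ n, of v w] by simp
qed

lemma add_closed_scale:
  assumes "add_closed M" "v \<in> M"
  shows "of_int k *s v \<in> M"
proof (induction k rule: int_induct[of _ 0])
  case base
  then show ?case using add_closedD(1)[OF assms(1)] by simp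
next
  case (step1 i)
  have "of_int (i + 1) *s v = of_int i *s v + v" by (simp add: vector_sadd_rdistrib)
  then show ?case using step1 add_closedD(4)[OF assms(1)] assms(2) by simp
next
  case (step2 i)
  have "of_int (i - 1) *s v = of_int i *s v - v" by (simp add: vec2_eq_iff algebra_simps)
  then show ?case using step2 add_closedD(2)[OF assms(1)] assms(2) by simp
qed

lemma add_closed_lat: "add_closed (lat a c d)"
  unfolding add_closed_def
proof (intro conjI ballI)
  show "0 \<in> lat a c d" unfolding mem_lat_iff by (intro exI[of _ 0]) simp
  fix v w assume "v \<in> lat a c d" "w \<in> lat a c d"
  then obtain x y x' y' where
    "v $ 1 = a * of_int x + c * of_int y" "v $ 2 = d * of_int y"
    "w $ 1 = a * of_int x' + c * of_int y'" "w $ 2 = d * of_int y'"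
    unfolding mem_lat_iff by blast
  then show "v - w \<in> lat a c d"
    unfolding mem_lat_iff by (intro exI[of _ "x - x'"] exI[of _ "y - y'"]) (simp add: algebra_simps)
qed

lemma group_add_group:
  assumes "add_closed M"
  shows "group (add_group M)"
proof (rule groupI)
  fix v assume "v \<in> carrier (add_group M)"
  then show "\<exists>w\<in>carrier (add_group M). w \<otimes>\<^bsub>add_group M\<^esub> v = \<one>\<^bsub>add_group M\<^esub>"
    using add_closedD(3)[OF assms] by (intro bexI[of _ "- v"]) (auto simp: add_group_def)
qed (use add_closedD[OF assms] in \<open>auto simp: add_group_def add.assoc\<close>)

lemma subgroup_add_group_iff:
  assumes "add_closed M"
  shows "subgroup K (add_group M) \<longleftrightarrow> K \<subseteq> M \<and> add_closed K"
proof -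
  interpret group "add_group M" by (rule group_add_group[OF assms])
  have inv: "inv\<^bsub>add_group M\<^esub> v = - v" if "v \<in> M" for v
    using that add_closedD(3)[OF assms] by (intro inv_equality) (auto simp: add_group_def)
  show ?thesis
  proof
    assume K: "subgroup K (add_group M)"
    have sub: "K \<subseteq> M" using subgroup.subset[OF K] by (simp add: add_group_def)
    have "v - w \<in> K" if "v \<in> K" "w \<in> K" for v w
    proof -
      have "- w \<in> K" using subgroup.m_inv_closed[OF K that(2)] inv that(2) sub by auto
      from subgroup.m_closed[OF K that(1) this] show ?thesis by (simp add: add_group_def)
    qed
    moreover have "0 \<in> K" using subgroup.one_closed[OF K] by (simp add: add_group_def)
    ultimately show "K \<subseteq> M \<and> add_closed K" using sub by (simp add: add_closed_def)
  next
    assume K: "K \<subseteq> M \<and> add_closed K"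
    show "subgroup K (add_group M)"
      by (rule subgroup.intro)
        (use K inv add_closedD[of K] in \<open>auto simp: add_group_def subset_iff\<close>)
  qed
qed

lemma rcosets_add_group: "rcosets\<^bsub>add_group M\<^esub> K = (\<lambda>v. (\<lambda>k. k + v) ` K) ` M"
  by (auto simp: RCOSETS_def r_coset_def add_group_def)

lemma translate_eq_iff:
  assumes "add_closed K"
  shows "(\<lambda>k. k + v) ` K = (\<lambda>k. k + w) ` K \<longleftrightarrow> v - w \<in> K"
proof
  assume "(\<lambda>k. k + v) ` K = (\<lambda>k. k + w) ` K"
  then have "0 + v \<in> (\<lambda>k. k + w) ` K" using add_closedD(1)[OF assms] by blast
  then show "v - w \<in> K" by auto
next
  assume vw: "v - w \<in> K"
  show "(\<lambda>k. k + v) ` K = (\<lambda>k. k + w) ` K"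
  proof (intro equalityI subsetI)
    fix u assume "u \<in> (\<lambda>k. k + v) ` K"
    then obtain k where "k \<in> K" "u = (k + (v - w)) + w" by auto
    then show "u \<in> (\<lambda>k. k + w) ` K" using add_closedD(4)[OF assms _ vw] by blast
  next
    fix u assume "u \<in> (\<lambda>k. k + w) ` K"
    then obtain k where "k \<in> K" "u = (k - (v - w)) + v" by auto
    then show "u \<in> (\<lambda>k. k + v) ` K" using add_closedD(2)[OF assms _ vw] by blast
  qed
qed

text \<open>
  The generator is the least positive element, by division with remainder. The positive element is
  assumed in order to exclude the zero subgroup.
\<close>

lemma int_subgroup_generator:
  fixes I :: "int set"
  assumes diff: "\<And>x y. x \<in> I \<Longrightarrow> y \<in> I \<Longrightarrow> x - y \<in> I" and n: "n \<in> I" "n > 0"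
  obtains g where "g > 0" "\<And>y. y \<in> I \<longleftrightarrow> g dvd y"
proof -
  define g where "g = (LEAST g. g > 0 \<and> int g \<in> I)"
  have "nat n > 0 \<and> int (nat n) \<in> I" using n by simp
  then have g: "g > 0 \<and> int g \<in> I" unfolding g_def by (rule LeastI)
  have zero: "0 \<in> I" using diff[OF n(1) n(1)] by simp
  have add: "x + y \<in> I" if "x \<in> I" "y \<in> I" for x y
    using diff[OF that(1) diff[OF zero that(2)]] by simp
  have mult: "x * k \<in> I" if "x \<in> I" for x k
  proof (induction k rule: int_induct[of _ 0])
    case (step1 i)
    then show ?case using add[OF step1(2) that] by (simp add: algebra_simps)
  next
    case (step2 i)
    then show ?case using diff[OF step2(2) that] by (simp add: algebra_simps)
  qed (simp add: zero)
  have "y \<in> I \<longleftrightarrow> int g dvd y" for y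
  proof
    assume y: "y \<in> I"
    have "y mod int g = y - int g * (y div int g)" by (simp add: minus_mult_div_eq_mod)
    then have mI: "y mod int g \<in> I" using diff[OF y mult] g by simp
    have r: "0 \<le> y mod int g" "y mod int g < int g" using g by simp_all
    have "\<not> nat (y mod int g) > 0"
    proof
      assume "nat (y mod int g) > 0"
      moreover have "int (nat (y mod int g)) \<in> I" using mI r by simp
      ultimately have "g \<le> nat (y mod int g)" unfolding g_def by (intro Least_le conjI)
      then show False using r by simp
    qed
    then show "int g dvd y" using r by (simp add: dvd_eq_mod_eq_0)
  next
    assume "int g dvd y"
    then show "y \<in> I" using mult g by (auto elim!: dvdE)
  qed
  then show thesis using that[of "int g"] g by simp
qed

context
  fixes a c d :: rat
  assumes ad: "a > 0" "d > 0"
begin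

text \<open>Coordinates with respect to the basis \<open>(a, 0)\<close>, \<open>(c, d)\<close>.\<close>

definition point :: "int \<Rightarrow> int \<Rightarrow> rat ^ 2" where
  "point x y = vector [a * of_int x + c * of_int y, d * of_int y]"

lemma point_nth: "point x y $ 1 = a * of_int x + c * of_int y" "point x y $ 2 = d * of_int y"
  by (simp_all add: point_def vector_2)

lemma point_diff: "point x y - point x' y' = point (x - x') (y - y')"
  by (simp add: vec2_eq_iff point_nth algebra_simps)

lemma point_add: "point x y + point x' y' = point (x + x') (y + y')"
  by (simp add: vec2_eq_iff point_nth algebra_simps)

lemma point_scale: "of_int k *s point x y = point (k * x) (k * y)"
  by (simp add: vec2_eq_iff point_nth algebra_simps)

lemma point_eq_iff: "point x y = point x' y' \<longleftrightarrow> x = x' \<and> y = y'"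
  using ad by (auto simp: vec2_eq_iff point_nth)

lemma lat_eq_range_point: "lat a c d = {point x y | x y. True}"
  by (simp add: lat_def point_def)

lemma point_in_sublat_iff:
  "point x y \<in> lat (a * of_int a') (a * of_int c' + c * of_int d') (d * of_int d') \<longleftrightarrow>
    (\<exists>p q. x = a' * p + c' * q \<and> y = d' * q)"
proof -
  have "lat (a * of_int a') (a * of_int c' + c * of_int d') (d * of_int d')
     = {point (a' * p + c' * q) (d' * q) | p q. True}"
    unfolding lat_def by (simp add: point_def algebra_simps)
  then show ?thesis by (auto simp: point_eq_iff)
qed

lemma sublat_subset: "lat (a * of_int a') (a * of_int c' + c * of_int d') (d * of_int d') \<subseteq> lat a c d"
proof
  fix v assume "v \<in> lat (a * of_int a') (a * of_int c' + c * of_int d') (d * of_int d')"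
  then obtain p q where "v $ 1 = a * of_int a' * of_int p + (a * of_int c' + c * of_int d') * of_int q"
    "v $ 2 = d * of_int d' * of_int q"
    unfolding mem_lat_iff by blast
  then show "v \<in> lat a c d"
    unfolding mem_lat_iff
    by (intro exI[of _ "a' * p + c' * q"] exI[of _ "d' * q"]) (simp add: algebra_simps)
qed

text \<open>
  The sublattice has basis \<open>a' v\<close>, \<open>c' v + d' w\<close> in terms of the basis \<open>v\<close>, \<open>w\<close> of the lattice. Reducing first
  the \<open>w\<close>-coordinate modulo \<open>d'\<close> and then the \<open>v\<close>-coordinate modulo \<open>a'\<close> brings every point into the box
  \<open>[0, a') \<times> [0, d')\<close>, and distinct points of the box are inequivalent.
\<close>

lemma bij_betw_rcosets_sublat:
  fixes a' c' d' :: int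
  assumes "a' > 0" "d' > 0"
  defines "K \<equiv> lat (a * of_int a') (a * of_int c' + c * of_int d') (d * of_int d')"
  shows "bij_betw (\<lambda>(i, j). (\<lambda>k. k + point i j) ` K) ({0..<a'} \<times> {0..<d'}) (rcosets\<^bsub>add_group (lat a c d)\<^esub> K)"
  unfolding bij_betw_def
proof
  have K: "add_closed K" unfolding K_def by (rule add_closed_lat)
  have coset: "(\<lambda>k. k + point x y) ` K = (\<lambda>k. k + point x' y') ` K \<longleftrightarrow>
      (\<exists>p q. x - x' = a' * p + c' * q \<and> y - y' = d' * q)" for x y x' y'
    unfolding translate_eq_iff[OF K] point_diff unfolding K_def point_in_sublat_iff ..
  \<comment> \<open>Congruent points of the box coincide because their coordinates differ by less than the modulus.\<close>
  have small: "z = 0" if "n dvd z" "\<bar>z\<bar> < n" for n z :: int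
    using that by (metis dvd_abs_iff linorder_not_le zdvd_imp_le zero_less_abs_iff)
  show "inj_on (\<lambda>(i, j). (\<lambda>k. k + point i j) ` K) ({0..<a'} \<times> {0..<d'})"
  proof (rule inj_onI, clarify)
    fix i j i' j' assume *: "i \<in> {0..<a'}" "j \<in> {0..<d'}" "i' \<in> {0..<a'}" "j' \<in> {0..<d'}"
      and eq: "(\<lambda>k. k + point i j) ` K = (\<lambda>k. k + point i' j') ` K"
    obtain p q where pq: "i - i' = a' * p + c' * q" "j - j' = d' * q"
      using coset[THEN iffD1, OF eq] by blast
    have "j - j' = 0" using small[of d' "j - j'"] pq(2) * by auto
    moreover from this have "q = 0" using pq(2) assms(2) by simp
    then have "i - i' = 0" using small[of a' "i - i'"] pq(1) * by auto
    ultimately show "i = i' \<and> j = j'" by simp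
  qed
  show "(\<lambda>(i, j). (\<lambda>k. k + point i j) ` K) ` ({0..<a'} \<times> {0..<d'}) = rcosets\<^bsub>add_group (lat a c d)\<^esub> K"
    unfolding rcosets_add_group
  proof (intro equalityI subsetI)
    fix X assume "X \<in> (\<lambda>(i, j). (\<lambda>k. k + point i j) ` K) ` ({0..<a'} \<times> {0..<d'})"
    then obtain i j where "X = (\<lambda>k. k + point i j) ` K" by auto
    moreover have "point i j \<in> lat a c d" unfolding lat_eq_range_point by blast
    ultimately show "X \<in> (\<lambda>v. (\<lambda>k. k + v) ` K) ` lat a c d" by (rule image_eqI)
  next
    fix X assume "X \<in> (\<lambda>v. (\<lambda>k. k + v) ` K) ` lat a c d"
    then obtain x y where X: "X = (\<lambda>k. k + point x y) ` K" unfolding lat_eq_range_point by blast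
    \<comment> \<open>The second coordinate is reduced first, since \<open>c' v + d' w\<close> also moves the first one.\<close>
    define q where "q = y div d'"
    define i j where "i = (x - c' * q) mod a'" and "j = y mod d'"
    have "y - j = d' * q" by (simp add: j_def q_def minus_mod_eq_mult_div)
    moreover have "x - i = a' * ((x - c' * q) div a') + c' * q"
      using mult_div_mod_eq[of a' "x - c' * q"] unfolding i_def by linarith
    ultimately have "\<exists>p q. x - i = a' * p + c' * q \<and> y - j = d' * q" by blast
    then have "X = (\<lambda>k. k + point i j) ` K" unfolding X by (rule coset[THEN iffD2])
    moreover have "i \<in> {0..<a'}" "j \<in> {0..<d'}" using assms by (simp_all add: i_def j_def)
    ultimately show "X \<in> (\<lambda>(i, j). (\<lambda>k. k + point i j) ` K) ` ({0..<a'} \<times> {0..<d'})" by force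
  qed
qed

lemma sublattice_sublat:
  fixes a' c' d' :: int
  assumes "a' > 0" "d' > 0"
  defines "K \<equiv> lat (a * of_int a') (a * of_int c' + c * of_int d') (d * of_int d')"
  shows "sublattice K (lat a c d)" "lattice_index (lat a c d) K = nat (a' * d')"
proof -
  note bij = bij_betw_rcosets_sublat[OF assms(1,2), of c', folded K_def]
  have "subgroup K (add_group (lat a c d))"
    using subgroup_add_group_iff[OF add_closed_lat] sublat_subset add_closed_lat unfolding K_def by blast
  then show "sublattice K (lat a c d)"
    unfolding sublattice_def using bij_betw_finite[OF bij] by simp
  show "lattice_index (lat a c d) K = nat (a' * d')"
    unfolding lattice_index_def using bij_betw_same_card[OF bij] assms(1,2)
    by (simp add: nat_mult_distrib)
qed

text \<open>
  The multiples of a point lie in finitely many cosets, so two of them differ by an element of \<open>K\<close>. This is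
  how the finite index makes \<open>K\<close> of full rank.
\<close>

lemma sublattice_imp_multiple_in:
  assumes "sublattice K (lat a c d)"
  shows "\<exists>n>0. point (n * x) (n * y) \<in> K"
proof -
  have sub: "add_closed K" and fin: "finite ((\<lambda>v. (\<lambda>k. k + v) ` K) ` lat a c d)"
    using assms unfolding sublattice_def rcosets_add_group subgroup_add_group_iff[OF add_closed_lat] by auto
  have "\<not> inj (\<lambda>n::nat. (\<lambda>k. k + point (int n * x) (int n * y)) ` K)"
  proof
    assume inj: "inj (\<lambda>n::nat. (\<lambda>k. k + point (int n * x) (int n * y)) ` K)"
    have "range (\<lambda>n::nat. (\<lambda>k. k + point (int n * x) (int n * y)) ` K) \<subseteq> (\<lambda>v. (\<lambda>k. k + v) ` K) ` lat a c d"
      unfolding lat_eq_range_point by blast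
    then have "finite (range (\<lambda>n::nat. (\<lambda>k. k + point (int n * x) (int n * y)) ` K))"
      using fin finite_subset by blast
    then show False using inj finite_imageD infinite_UNIV_nat by blast
  qed
  then obtain m n :: nat where mn: "m \<noteq> n"
    "(\<lambda>k. k + point (int m * x) (int m * y)) ` K = (\<lambda>k. k + point (int n * x) (int n * y)) ` K"
    unfolding inj_def by blast
  have *: "point ((int m - int n) * x) ((int m - int n) * y) \<in> K"
    using mn(2) unfolding translate_eq_iff[OF sub] point_diff by (simp add: algebra_simps)
  have "point (k * ((int m - int n) * x)) (k * ((int m - int n) * y)) \<in> K" for k
    using add_closed_scale[OF sub *, of k] unfolding point_scale .
  \<comment> \<open>The order of \<open>m\<close> and \<open>n\<close> is unknown, so the sign is normalised.\<close>
  from this[of "sgn (int m - int n)"] have "point (\<bar>int m - int n\<bar> * x) (\<bar>int m - int n\<bar> * y) \<in> K"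
    by (simp add: abs_sgn mult_ac)
  then show ?thesis using mn(1) by (intro exI[of _ "\<bar>int m - int n\<bar>"]) simp
qed

text \<open>
  Hermite normal form: \<open>d'\<close> generates the second coordinates of \<open>K\<close>, \<open>a'\<close> generates the first
  coordinates of the points of \<open>K\<close> on the isotropic line, and \<open>c'\<close> is any first coordinate above \<open>d'\<close>.
\<close>

lemma sublattice_normal_form:
  assumes "sublattice K (lat a c d)"
  obtains a' c' d' where "a' > 0" "d' > 0"
    "K = lat (a * of_int a') (a * of_int c' + c * of_int d') (d * of_int d')"
proof -
  have sub: "add_closed K" "K \<subseteq> lat a c d"
    using assms unfolding sublattice_def subgroup_add_group_iff[OF add_closed_lat] by auto
  define J where "J = {x. point x 0 \<in> K}"
  define I where "I = {y. \<exists>x. point x y \<in> K}"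
  have dJ: "x - y \<in> J" if "x \<in> J" "y \<in> J" for x y
    using add_closedD(2)[OF sub(1), of "point x 0" "point y 0"] that by (simp add: J_def point_diff)
  have dI: "x - y \<in> I" if xy: "x \<in> I" "y \<in> I" for x y
  proof -
    obtain x' y' where "point x' x \<in> K" "point y' y \<in> K" using xy unfolding I_def by blast
    then have "point (x' - y') (x - y) \<in> K"
      using add_closedD(2)[OF sub(1)] point_diff by metis
    then show ?thesis unfolding I_def by blast
  qed
  obtain n where n: "n > 0" "n \<in> J" using sublattice_imp_multiple_in[OF assms, of 1 0] by (auto simp: J_def)
  obtain m where m: "m > 0" "m \<in> I" using sublattice_imp_multiple_in[OF assms, of 0 1] by (auto simp: I_def)
  obtain a' where a': "a' > 0" "\<And>y. y \<in> J \<longleftrightarrow> a' dvd y" using int_subgroup_generator[OF dJ n(2,1)] by blast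
  obtain d' where d': "d' > 0" "\<And>y. y \<in> I \<longleftrightarrow> d' dvd y" using int_subgroup_generator[OF dI m(2,1)] by blast
  have "d' \<in> I" using d'(2) by simp
  then obtain c' where c': "point c' d' \<in> K" unfolding I_def by blast
  have c'q: "point (c' * q) (d' * q) \<in> K" for q
    using add_closed_scale[OF sub(1) c', of q] unfolding point_scale by (simp add: mult_ac)
  have "point x y \<in> K \<longleftrightarrow> (\<exists>p q. x = a' * p + c' * q \<and> y = d' * q)" for x y
  proof
    assume xy: "point x y \<in> K"
    then have "d' dvd y" using d'(2) unfolding I_def by blast
    then obtain q where q: "y = d' * q" by (elim dvdE)
    have "point (x - c' * q) 0 \<in> K"
      using add_closedD(2)[OF sub(1) xy c'q[of q]] by (simp add: point_diff q)
    then have "a' dvd x - c' * q" using a'(2) by (simp add: J_def)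
    then obtain p where "x - c' * q = a' * p" by (elim dvdE)
    then show "\<exists>p q. x = a' * p + c' * q \<and> y = d' * q" using q by (intro exI[of _ p] exI[of _ q]) simp
  next
    assume "\<exists>p q. x = a' * p + c' * q \<and> y = d' * q"
    then obtain p q where pq: "x = a' * p + c' * q" "y = d' * q" by blast
    have "a' * p \<in> J" using a'(2) by simp
    then have "point (a' * p) 0 \<in> K" by (simp add: J_def)
    from add_closedD(4)[OF sub(1) this c'q[of q]] show "point x y \<in> K"
      by (simp add: point_add pq)
  qed
  then have iff: "point x y \<in> K \<longleftrightarrow> point x y \<in> lat (a * of_int a') (a * of_int c' + c * of_int d') (d * of_int d')" for x y
    unfolding point_in_sublat_iff .
  have "K = lat (a * of_int a') (a * of_int c' + c * of_int d') (d * of_int d')"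
  proof (intro equalityI subsetI)
    fix v assume v: "v \<in> K"
    then obtain x y where "v = point x y" using sub(2) unfolding lat_eq_range_point by blast
    then show "v \<in> lat (a * of_int a') (a * of_int c' + c * of_int d') (d * of_int d')" using iff v by simp
  next
    fix v assume v: "v \<in> lat (a * of_int a') (a * of_int c' + c * of_int d') (d * of_int d')"
    then obtain x y where "v = point x y" using sublat_subset unfolding lat_eq_range_point by blast
    then show "v \<in> K" using iff v by simp
  qed
  then show thesis using that a'(1) d'(1) by blast
qed

end

section \<open>Proper isometry classes and slopes\<close>

lemma matrix_vector_mult_2:
  fixes A :: "rat ^ 2 ^ 2"
  shows "(A *v v) $ 1 = A $ 1 $ 1 * v $ 1 + A $ 1 $ 2 * v $ 2" "(A *v v) $ 2 = A $ 2 $ 1 * v $ 1 + A $ 2 $ 2 * v $ 2"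
  by (simp_all add: matrix_vector_mult_def sum_2)

lemma Bform_eq: "Bform v w = (v $ 1 * w $ 2 + v $ 2 * w $ 1) / 2"
  by (simp add: Bform_def Qform_def algebra_simps)

text \<open>
  Isotropy of the images of the two basis vectors gives \<open>p r = q w = 0\<close> for a matrix with rows \<open>(p, q)\<close> and
  \<open>(r, w)\<close>. Their pairing gives \<open>p w + q r = 1\<close>, and determinant one gives \<open>p w - q r = 1\<close>, so \<open>p w = 1\<close> and
  the off-diagonal entries vanish.
\<close>

lemma proper_orthogonal_group_iff:
  "\<sigma> \<in> proper_orthogonal_group \<longleftrightarrow> (\<exists>t. t \<noteq> 0 \<and> (\<forall>v. \<sigma> *v v = vector [t * v $ 1, v $ 2 / t]))"
proof
  assume \<sigma>: "\<sigma> \<in> proper_orthogonal_group"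
  define p q r w where "p = \<sigma> $ 1 $ 1" and "q = \<sigma> $ 1 $ 2" and "r = \<sigma> $ 2 $ 1" and "w = \<sigma> $ 2 $ 2"
  have B: "Bform (\<sigma> *v x) (\<sigma> *v y) = Bform x y" for x y
    using \<sigma> by (auto simp: proper_orthogonal_group_def orthogonal_group_def)
  have det: "p * w - q * r = 1"
    using \<sigma> by (simp add: proper_orthogonal_group_def det_2 p_def q_def r_def w_def)
  have "p * r = 0" using B[of "vector [1, 0]" "vector [1, 0]"]
    by (simp add: Bform_eq matrix_vector_mult_2 p_def r_def vector_2)
  moreover have "q * w = 0" using B[of "vector [0, 1]" "vector [0, 1]"]
    by (simp add: Bform_eq matrix_vector_mult_2 q_def w_def vector_2)
  moreover have "p * w + r * q = 1" using B[of "vector [1, 0]" "vector [0, 1]"]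
    by (simp add: Bform_eq matrix_vector_mult_2 p_def q_def r_def w_def vector_2)
  ultimately have pw: "p * w = 1" and "p * r = 0" "q * w = 0" using det by (simp_all add: mult.commute)
  moreover from pw have "p \<noteq> 0" "w \<noteq> 0" by auto
  ultimately have "p \<noteq> 0" "r = 0" "q = 0" "w = 1 / p" by (simp_all add: eq_divide_eq mult.commute)
  then show "\<exists>t. t \<noteq> 0 \<and> (\<forall>v. \<sigma> *v v = vector [t * v $ 1, v $ 2 / t])"
    by (intro exI[of _ p]) (simp add: vec2_eq_iff matrix_vector_mult_2 vector_2 flip: p_def q_def r_def w_def)
next
  assume "\<exists>t. t \<noteq> 0 \<and> (\<forall>v. \<sigma> *v v = vector [t * v $ 1, v $ 2 / t])"
  then obtain t where t: "t \<noteq> 0" "\<And>v. \<sigma> *v v = vector [t * v $ 1, v $ 2 / t]" by blast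
  have "\<sigma> $ 1 $ 1 = t" "\<sigma> $ 2 $ 1 = 0" "\<sigma> $ 1 $ 2 = 0" "\<sigma> $ 2 $ 2 = 1 / t"
    using t(2)[of "vector [1, 0]"] t(2)[of "vector [0, 1]"]
    by (simp_all add: vec2_eq_iff matrix_vector_mult_2 vector_2)
  then have "det \<sigma> = 1" using t(1) by (simp add: det_2)
  then show "\<sigma> \<in> proper_orthogonal_group"
    using t by (simp add: proper_orthogonal_group_def orthogonal_group_def invertible_det_nz Bform_eq vector_2)
qed

lemma properly_isometric_iff:
  "properly_isometric K\<^sub>1 K\<^sub>2 \<longleftrightarrow> (\<exists>t. t \<noteq> 0 \<and> (\<lambda>v. vector [t * v $ 1, v $ 2 / t]) ` K\<^sub>1 = K\<^sub>2)"
proof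
  assume "properly_isometric K\<^sub>1 K\<^sub>2"
  then obtain \<sigma> where \<sigma>: "\<sigma> \<in> proper_orthogonal_group" "(*v) \<sigma> ` K\<^sub>1 = K\<^sub>2"
    unfolding properly_isometric_def by blast
  obtain t where t: "t \<noteq> 0" "\<forall>v. \<sigma> *v v = vector [t * v $ 1, v $ 2 / t]"
    using iffD1[OF proper_orthogonal_group_iff \<sigma>(1)] by (elim exE conjE)
  from t(2) have "(*v) \<sigma> = (\<lambda>v. vector [t * v $ 1, v $ 2 / t])" by (intro ext) (rule spec)
  with \<sigma>(2) t(1) show "\<exists>t. t \<noteq> 0 \<and> (\<lambda>v. vector [t * v $ 1, v $ 2 / t]) ` K\<^sub>1 = K\<^sub>2"
    by (intro exI[of _ t]) simp
next
  assume "\<exists>t. t \<noteq> 0 \<and> (\<lambda>v. vector [t * v $ 1, v $ 2 / t]) ` K\<^sub>1 = K\<^sub>2"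
  then obtain t where t: "t \<noteq> 0" "(\<lambda>v. vector [t * v $ 1, v $ 2 / t]) ` K\<^sub>1 = K\<^sub>2" by blast
  define \<sigma> :: "rat ^ 2 ^ 2" where "\<sigma> = vector [vector [t, 0], vector [0, 1 / t]]"
  have \<sigma>: "\<sigma> *v v = vector [t * v $ 1, v $ 2 / t]" for v
    by (simp add: vec2_eq_iff matrix_vector_mult_2 vector_2 \<sigma>_def)
  then have "(*v) \<sigma> = (\<lambda>v. vector [t * v $ 1, v $ 2 / t])" by (intro ext)
  moreover have "\<sigma> \<in> proper_orthogonal_group"
    unfolding proper_orthogonal_group_iff using t(1) \<sigma> by (intro exI[of _ t] conjI allI)
  ultimately show "properly_isometric K\<^sub>1 K\<^sub>2"
    unfolding properly_isometric_def using t(2) by (intro bexI[of _ \<sigma>]) simp_all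
qed

lemma stretch_lat:
  "(\<lambda>v. vector [t * v $ 1, v $ 2 / t]) ` lat a c d = lat (t * a) (t * c) (d / t)"
proof -
  have "f ` {g x y | x y. True} = {f (g x y) | x y. True}"
    for f :: "rat ^ 2 \<Rightarrow> rat ^ 2" and g :: "int \<Rightarrow> int \<Rightarrow> rat ^ 2" by blast
  then show ?thesis unfolding lat_def by (simp add: vector_2 distrib_left mult.assoc)
qed

lemma lat_uminus: "lat (- a) (- c) (- d) = lat a c d"
proof -
  have "v \<in> lat (- a) (- c) (- d)" if v: "v \<in> lat a c d" for v a c d
  proof -
    obtain x y where "v $ 1 = a * of_int x + c * of_int y" "v $ 2 = d * of_int y"
      using v unfolding mem_lat_iff by blast
    then show ?thesis unfolding mem_lat_iff by (intro exI[of _ "- x"] exI[of _ "- y"]) simp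
  qed
  from this[of _ a c d] this[of _ "- a" "- c" "- d"] show ?thesis by auto
qed

text \<open>The two integer factors are inverse to each other and positive, hence equal to one.\<close>

lemma mutual_multiples_eq:
  fixes a b :: rat
  assumes "a > 0" "b > 0" "a = b * of_int x" "b = a * of_int y"
  shows "a = b"
proof -
  have "a = a * of_int (x * y)" using assms(3,4) by (metis mult.assoc mult.commute of_int_mult)
  then have "(of_int (x * y) :: rat) = of_int 1" using assms(1) by simp
  then have "x * y = 1" by (simp only: of_int_eq_iff)
  moreover have "x > 0" using assms(1-3) by (simp add: zero_less_mult_iff)
  ultimately have "x = 1" by (metis zmult_eq_1_iff zero_less_one not_less_iff_gr_or_eq neg_less_0_iff_less)
  then show ?thesis using assms(3) by simp
qed

text \<open>
  The positive number \<open>a\<close> generates the intersection of the lattice with the first axis and \<open>d\<close> generates its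
  projection to the second axis. The points \<open>(c, d)\<close> above \<open>d\<close> differ by multiples of \<open>(a, 0)\<close>.
\<close>

lemma lat_eq_iff:
  assumes "a\<^sub>1 > 0" "d\<^sub>1 > 0" "a\<^sub>2 > 0" "d\<^sub>2 > 0"
  shows "lat a\<^sub>1 c\<^sub>1 d\<^sub>1 = lat a\<^sub>2 c\<^sub>2 d\<^sub>2 \<longleftrightarrow> a\<^sub>1 = a\<^sub>2 \<and> d\<^sub>1 = d\<^sub>2 \<and> (c\<^sub>1 - c\<^sub>2) / a\<^sub>1 \<in> \<int>"
proof
  have gen: "vector [a, 0] \<in> lat a c d" "vector [c, d] \<in> lat a c d" for a c d
    unfolding mem_lat_iff
    by (rule exI[of _ 1], rule exI[of _ 0], simp add: vector_2)
       (rule exI[of _ 0], rule exI[of _ 1], simp add: vector_2)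
  assume eq: "lat a\<^sub>1 c\<^sub>1 d\<^sub>1 = lat a\<^sub>2 c\<^sub>2 d\<^sub>2"
  have *: "(\<exists>x. a = a' * of_int x) \<and> (\<exists>x y. c = a' * of_int x + c' * of_int y \<and> d = d' * of_int y)"
    if h: "lat a c d = lat a' c' d'" "d' > 0" for a c d a' c' d' :: rat
  proof
    obtain x y where "a = a' * of_int x + c' * of_int y" "0 = d' * of_int y"
      using gen(1)[of a c d] unfolding h(1) mem_lat_iff vector_2 by blast
    then show "\<exists>x. a = a' * of_int x" using h(2) by (intro exI[of _ x]) simp
    show "\<exists>x y. c = a' * of_int x + c' * of_int y \<and> d = d' * of_int y"
      using gen(2)[of c d a] unfolding h(1) mem_lat_iff vector_2 .
  qed
  obtain x y z where 1: "a\<^sub>1 = a\<^sub>2 * of_int x" "c\<^sub>1 = a\<^sub>2 * of_int y + c\<^sub>2 * of_int z" "d\<^sub>1 = d\<^sub>2 * of_int z"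
    using *[OF eq assms(4)] by blast
  obtain x' z' where 2: "a\<^sub>2 = a\<^sub>1 * of_int x'" "d\<^sub>2 = d\<^sub>1 * of_int z'"
    using *[OF eq[symmetric] assms(2)] by blast
  have a: "a\<^sub>1 = a\<^sub>2" using mutual_multiples_eq[OF assms(1,3) 1(1) 2(1)] .
  have d: "d\<^sub>1 = d\<^sub>2" using mutual_multiples_eq[OF assms(2,4) 1(3) 2(2)] .
  then have "z = 1" using 1(3) assms by simp
  then have "(c\<^sub>1 - c\<^sub>2) / a\<^sub>1 = of_int y" using 1(2) a assms by simp
  then show "a\<^sub>1 = a\<^sub>2 \<and> d\<^sub>1 = d\<^sub>2 \<and> (c\<^sub>1 - c\<^sub>2) / a\<^sub>1 \<in> \<int>" using a d by simp
next
  assume h: "a\<^sub>1 = a\<^sub>2 \<and> d\<^sub>1 = d\<^sub>2 \<and> (c\<^sub>1 - c\<^sub>2) / a\<^sub>1 \<in> \<int>"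
  then obtain k where "(c\<^sub>1 - c\<^sub>2) / a\<^sub>1 = of_int k" by (auto elim: Ints_cases)
  then have k: "c\<^sub>1 = c\<^sub>2 + a\<^sub>2 * of_int k" using h assms by (simp add: field_simps)
  have sub: "lat a (c + a * of_int k) d \<subseteq> lat a c d" for a c d k
  proof
    fix v assume "v \<in> lat a (c + a * of_int k) d"
    then obtain x y where "v $ 1 = a * of_int x + (c + a * of_int k) * of_int y" "v $ 2 = d * of_int y"
      unfolding mem_lat_iff by blast
    then show "v \<in> lat a c d"
      unfolding mem_lat_iff by (intro exI[of _ "x + k * y"] exI[of _ y]) (simp add: algebra_simps)
  qed
  show "lat a\<^sub>1 c\<^sub>1 d\<^sub>1 = lat a\<^sub>2 c\<^sub>2 d\<^sub>2"
    using sub[of a\<^sub>2 c\<^sub>2 k d\<^sub>2] sub[of a\<^sub>2 "c\<^sub>2 + a\<^sub>2 * of_int k" "- k" d\<^sub>2] h k by auto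
qed

text \<open>
  Scaling by \<open>t > 0\<close> fixes the covolume \<open>a d\<close> and the slope \<open>c / a\<close> and makes \<open>a\<close> arbitrary; \<open>t < 0\<close> gives
  nothing new because every lattice is stable under negation.
\<close>

lemma properly_isometric_lat_iff:
  assumes "a\<^sub>1 > 0" "d\<^sub>1 > 0" "a\<^sub>2 > 0" "d\<^sub>2 > 0" "a\<^sub>1 * d\<^sub>1 = a\<^sub>2 * d\<^sub>2"
  shows "properly_isometric (lat a\<^sub>1 c\<^sub>1 d\<^sub>1) (lat a\<^sub>2 c\<^sub>2 d\<^sub>2) \<longleftrightarrow> c\<^sub>1 / a\<^sub>1 - c\<^sub>2 / a\<^sub>2 \<in> \<int>"
proof
  assume "properly_isometric (lat a\<^sub>1 c\<^sub>1 d\<^sub>1) (lat a\<^sub>2 c\<^sub>2 d\<^sub>2)"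
  then obtain t where t: "t \<noteq> 0" "lat (t * a\<^sub>1) (t * c\<^sub>1) (d\<^sub>1 / t) = lat a\<^sub>2 c\<^sub>2 d\<^sub>2"
    unfolding properly_isometric_iff stretch_lat by blast
  \<comment> \<open>Negating all three parameters does not change the lattice, so \<open>t\<close> may be taken positive.\<close>
  define u where "u = \<bar>t\<bar>"
  have u: "u > 0" using t(1) by (simp add: u_def)
  have "lat (u * a\<^sub>1) (u * c\<^sub>1) (d\<^sub>1 / u) = lat (t * a\<^sub>1) (t * c\<^sub>1) (d\<^sub>1 / t)"
    using lat_uminus[of "t * a\<^sub>1" "t * c\<^sub>1" "d\<^sub>1 / t"] by (cases "t > 0") (simp_all add: u_def)
  then have "lat (u * a\<^sub>1) (u * c\<^sub>1) (d\<^sub>1 / u) = lat a\<^sub>2 c\<^sub>2 d\<^sub>2" using t(2) by (rule trans)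
  moreover have "u * a\<^sub>1 > 0" "d\<^sub>1 / u > 0" using assms u by simp_all
  ultimately have ua: "u * a\<^sub>1 = a\<^sub>2" and "(u * c\<^sub>1 - c\<^sub>2) / (u * a\<^sub>1) \<in> \<int>"
    using lat_eq_iff assms(3,4) by blast+
  moreover have "(u * c\<^sub>1 - c\<^sub>2) / (u * a\<^sub>1) = c\<^sub>1 / a\<^sub>1 - c\<^sub>2 / a\<^sub>2"
    unfolding ua[symmetric] using u by (simp add: diff_divide_distrib)
  ultimately show "c\<^sub>1 / a\<^sub>1 - c\<^sub>2 / a\<^sub>2 \<in> \<int>" by simp
next
  assume c: "c\<^sub>1 / a\<^sub>1 - c\<^sub>2 / a\<^sub>2 \<in> \<int>"
  define t where "t = a\<^sub>2 / a\<^sub>1"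
  have t: "t > 0" using assms by (simp add: t_def)
  have ta: "t * a\<^sub>1 = a\<^sub>2" "d\<^sub>1 / t = d\<^sub>2" "(t * c\<^sub>1 - c\<^sub>2) / a\<^sub>2 = c\<^sub>1 / a\<^sub>1 - c\<^sub>2 / a\<^sub>2"
    using assms by (simp_all add: t_def field_simps)
  have "lat (t * a\<^sub>1) (t * c\<^sub>1) (d\<^sub>1 / t) = lat a\<^sub>2 c\<^sub>2 d\<^sub>2"
    unfolding ta(1,2) using lat_eq_iff[of a\<^sub>2 d\<^sub>2 a\<^sub>2 d\<^sub>2 "t * c\<^sub>1" c\<^sub>2] assms c ta(3) by simp
  then show "properly_isometric (lat a\<^sub>1 c\<^sub>1 d\<^sub>1) (lat a\<^sub>2 c\<^sub>2 d\<^sub>2)"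
    unfolding properly_isometric_iff stretch_lat using t by (intro exI[of _ t]) simp
qed

lemma frac_eq_iff_rat: "frac x = frac y \<longleftrightarrow> x - y \<in> \<int>" for x y :: rat
proof -
  have "x - y = (x - frac y) - of_int \<lfloor>y\<rfloor>" by (simp add: frac_def)
  then have "x - y \<in> \<int> \<longleftrightarrow> x - frac y \<in> \<int>" by (metis diff_in_Ints_iff_right Ints_of_int)
  then show ?thesis using frac_unique_iff[of x "frac y"] by (simp add: frac_lt_1)
qed

text \<open>
  The slope \<open>c / a\<close> of a lattice is only defined modulo one, whence the fractional part.
\<close>

definition slope :: "(rat ^ 2) set \<Rightarrow> rat" where
  "slope K = (THE x. \<exists>a c d. a > 0 \<and> d > 0 \<and> K = lat a c d \<and> x = frac (c / a))"

lemma slope_lat: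
  assumes "a > 0" "d > 0"
  shows "slope (lat a c d) = frac (c / a)"
  unfolding slope_def
proof (rule the_equality)
  fix x assume "\<exists>a' c' d'. a' > 0 \<and> d' > 0 \<and> lat a c d = lat a' c' d' \<and> x = frac (c' / a')"
  then obtain a' c' d' where *: "a' > 0" "d' > 0" "lat a c d = lat a' c' d'" "x = frac (c' / a')" by blast
  then have "a = a'" "(c - c') / a \<in> \<int>" using lat_eq_iff[OF assms *(1,2)] by blast+
  then have "frac (c / a) = frac (c' / a')" by (simp add: frac_eq_iff_rat diff_divide_distrib)
  then show "x = frac (c / a)" using * by simp
qed (use assms in blast)

lemma card_quotient_kernel: "card (A // {(x, y). x \<in> A \<and> y \<in> A \<and> f x = f y}) = card (f ` A)"
proof -
  let ?g = "\<lambda>z. {y \<in> A. z = f y}"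
  have "{(x, y). x \<in> A \<and> y \<in> A \<and> f x = f y} `` {x} = ?g (f x)" if "x \<in> A" for x
    using that by auto
  then have "A // {(x, y). x \<in> A \<and> y \<in> A \<and> f x = f y} = ?g ` f ` A"
    unfolding quotient_def by blast
  moreover have "inj_on ?g (f ` A)" by (rule inj_onI) auto
  ultimately show ?thesis by (simp add: card_image)
qed

text \<open>
  The rationals in \<open>[0, 1)\<close> represent \<open>\<rat>/\<int>\<close>. With \<open>b = 1\<close> these are the slopes of the sublattices of index \<open>m\<close> in a
  lattice of slope \<open>\<theta>\<close>; other values of \<open>b\<close> arise when they are sorted by the order of \<open>a x\<close>.
\<close>

definition slopes :: "nat \<Rightarrow> nat \<Rightarrow> rat \<Rightarrow> rat set" where
  "slopes b m \<theta> = {x. 0 \<le> x \<and> x < 1 \<and>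
     (\<exists>a d. a * d = m \<and> coprime d b \<and> of_nat a * x - of_nat d * \<theta> \<in> \<int>)}"

text \<open>
  The sublattice with parameters \<open>a'\<close>, \<open>c'\<close>, \<open>d'\<close> has slope \<open>x = (c' + d' \<theta>) / a'\<close>, where \<open>\<theta> = c / a\<close>. Letting \<open>c'\<close> range
  over all integers says precisely that \<open>a' x - d' \<theta>\<close> is an integer. All these sublattices have the same covolume,
  so their classes are separated by the slope.
\<close>

lemma num_proper_classes_lat:
  assumes ad: "a > 0" "d > 0" and m: "m > 0"
  shows "num_proper_classes (lat a c d) m = card (slopes 1 m (c / a))"
proof -
  define A where "A = sublattices_of_index (lat a c d) m"
  have form: "\<exists>a' c' d'. a' > 0 \<and> d' > 0 \<and> nat (a' * d') = m \<and>
      K = lat (a * of_int a') (a * of_int c' + c * of_int d') (d * of_int d')" if "K \<in> A" for K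
  proof -
    have K: "sublattice K (lat a c d)" "lattice_index (lat a c d) K = m"
      using that by (auto simp: A_def sublattices_of_index_def)
    obtain a' c' d' where *: "a' > 0" "d' > 0" "K = lat (a * of_int a') (a * of_int c' + c * of_int d') (d * of_int d')"
      using sublattice_normal_form[OF ad K(1)] by blast
    then have "nat (a' * d') = m" using sublattice_sublat(2)[OF ad *(1,2)] K(2) by metis
    then show ?thesis using * by blast
  qed
  have ratio: "(a * of_int c' + c * of_int d') / (a * of_int a') = (of_int c' + of_int d' * (c / a)) / of_int a'"
    if "a' > 0" for a' c' d' :: int
    using ad that by (simp add: field_simps)
  have iso: "properly_isometric K\<^sub>1 K\<^sub>2 \<longleftrightarrow> slope K\<^sub>1 = slope K\<^sub>2" if K: "K\<^sub>1 \<in> A" "K\<^sub>2 \<in> A" for K\<^sub>1 K\<^sub>2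
  proof -
    obtain a\<^sub>1 c\<^sub>1 d\<^sub>1 where 1: "a\<^sub>1 > 0" "d\<^sub>1 > 0" "nat (a\<^sub>1 * d\<^sub>1) = m"
      "K\<^sub>1 = lat (a * of_int a\<^sub>1) (a * of_int c\<^sub>1 + c * of_int d\<^sub>1) (d * of_int d\<^sub>1)" using form[OF K(1)] by blast
    obtain a\<^sub>2 c\<^sub>2 d\<^sub>2 where 2: "a\<^sub>2 > 0" "d\<^sub>2 > 0" "nat (a\<^sub>2 * d\<^sub>2) = m"
      "K\<^sub>2 = lat (a * of_int a\<^sub>2) (a * of_int c\<^sub>2 + c * of_int d\<^sub>2) (d * of_int d\<^sub>2)" using form[OF K(2)] by blast
    have pos: "a * of_int a\<^sub>1 > 0" "d * of_int d\<^sub>1 > 0" "a * of_int a\<^sub>2 > 0" "d * of_int d\<^sub>2 > 0"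
      using ad 1 2 by simp_all
    have "a\<^sub>1 * d\<^sub>1 = a\<^sub>2 * d\<^sub>2" using 1(1-3) 2(1-3) by (metis nat_eq_iff mult_pos_pos less_le eq_nat_nat_iff)
    then have "of_int (a\<^sub>1 * d\<^sub>1) = (of_int (a\<^sub>2 * d\<^sub>2) :: rat)" by simp
    then have area: "a * of_int a\<^sub>1 * (d * of_int d\<^sub>1) = a * of_int a\<^sub>2 * (d * of_int d\<^sub>2)"
      using ad by simp
    show ?thesis
      unfolding 1(4) 2(4) properly_isometric_lat_iff[OF pos area] slope_lat[OF pos(1,2)] slope_lat[OF pos(3,4)]
        frac_eq_iff_rat ..
  qed
  have rel: "{(K\<^sub>1, K\<^sub>2). K\<^sub>1 \<in> A \<and> K\<^sub>2 \<in> A \<and> properly_isometric K\<^sub>1 K\<^sub>2}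
      = {(K\<^sub>1, K\<^sub>2). K\<^sub>1 \<in> A \<and> K\<^sub>2 \<in> A \<and> slope K\<^sub>1 = slope K\<^sub>2}"
    using iso by blast
  have "slope ` A = slopes 1 m (c / a)"
  proof (intro equalityI subsetI)
    fix x assume "x \<in> slope ` A"
    then obtain K where K: "K \<in> A" "x = slope K" by blast
    obtain a' c' d' where *: "a' > 0" "d' > 0" "nat (a' * d') = m"
      "K = lat (a * of_int a') (a * of_int c' + c * of_int d') (d * of_int d')" using form[OF K(1)] by blast
    have x: "x = frac ((of_int c' + of_int d' * (c / a)) / of_int a')"
    proof -
      have "a * of_int a' > 0" "d * of_int d' > 0" using ad *(1,2) by simp_all
      then show ?thesis unfolding K(2) *(4) by (simp only: slope_lat ratio[OF *(1)])
    qed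
    define y where "y = (of_int c' + of_int d' * (c / a)) / of_int a'"
    have "of_int a' * y - of_int d' * (c / a) = of_int c'" using *(1) by (simp add: y_def)
    moreover have "of_int a' * x - of_int d' * (c / a) = (of_int a' * y - of_int d' * (c / a)) - of_int (a' * \<lfloor>y\<rfloor>)"
      unfolding x y_def[symmetric] by (simp add: frac_def algebra_simps)
    ultimately have "of_int a' * x - of_int d' * (c / a) = of_int (c' - a' * \<lfloor>y\<rfloor>)" by simp
    then have i: "of_int a' * x - of_int d' * (c / a) \<in> \<int>" by (metis Ints_of_int)
    show "x \<in> slopes 1 m (c / a)"
      unfolding slopes_def
    proof (intro CollectI conjI exI)
      show "nat a' * nat d' = m" using * by (simp add: nat_mult_distrib)
      show "of_nat (nat a') * x - of_nat (nat d') * (c / a) \<in> \<int>" using i *(1,2) by simp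
    qed (use x in \<open>auto simp: frac_lt_1\<close>)
  next
    fix x assume "x \<in> slopes 1 m (c / a)"
    then obtain a' d' where x: "0 \<le> x" "x < 1" "a' * d' = m" "of_nat a' * x - of_nat d' * (c / a) \<in> \<int>"
      unfolding slopes_def by blast
    then obtain c' where c': "of_nat a' * x - of_nat d' * (c / a) = of_int c'" by (auto elim: Ints_cases)
    have pos: "int a' > 0" "int d' > 0" using x(3) m by (auto intro!: Nat.gr0I)
    define K where "K = lat (a * of_int (int a')) (a * of_int c' + c * of_int (int d')) (d * of_int (int d'))"
    have "K \<in> A"
      using sublattice_sublat[where c = c and c' = c', OF ad pos] x(3) unfolding A_def sublattices_of_index_def K_def
      by (simp flip: of_nat_mult)
    moreover have "slope K = x"
    proof -
      have "x = (of_int c' + of_int (int d') * (c / a)) / of_int (int a')" using c' pos by (simp add: field_simps)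
      moreover have "frac x = x" using x(1,2) by (simp add: frac_eq)
      ultimately show ?thesis
        using ad pos unfolding K_def by (subst slope_lat) (simp_all only: ratio[OF pos(1)] mult_pos_pos of_int_0_less_iff)
    qed
    ultimately show "x \<in> slope ` A" by blast
  qed
  then show ?thesis
    unfolding num_proper_classes_def A_def[symmetric] rel card_quotient_kernel by simp
qed

section \<open>The norm ideal\<close>

lemma hyperbolic_eq_lat: "hyperbolic = lat 1 0 1"
  by (auto simp: hyperbolic_def mem_lat_iff forall_2 elim!: Ints_cases)

text \<open>
  On \<open>lat a c d\<close> the form takes the values \<open>a d x y + c d y\<^sup>2\<close> with integers \<open>x\<close>, \<open>y\<close>, so the norm ideal is generated
  by \<open>a d\<close> and \<open>c d\<close>.
\<close>

lemma frac_ideal_inverse_norm_ideal_lat: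
  "q \<in> frac_ideal_inverse (norm_ideal (lat a c d)) \<longleftrightarrow> q * (a * d) \<in> \<int> \<and> q * (c * d) \<in> \<int>"
proof -
  interpret module "\<lambda>(k::int) (q::rat). of_int k * q"
    by unfold_locales (simp_all add: algebra_simps)
  have sub: "subspace {x. q * x \<in> \<int>}"
  proof (rule subspaceI)
    fix k x assume "x \<in> {x. q * x \<in> \<int>}"
    then have "of_int k * (q * x) \<in> \<int>" by simp
    then show "of_int k * x \<in> {x. q * x \<in> \<int>}" by (simp only: mem_Collect_eq mult.left_commute)
  qed (auto simp: distrib_left)
  have "norm_ideal (lat a c d) \<subseteq> {x. q * x \<in> \<int>} \<longleftrightarrow> Qform ` lat a c d \<subseteq> {x. q * x \<in> \<int>}"
    unfolding norm_ideal_def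
    by (rule iffI[OF subset_trans[OF span_superset] span_minimal[OF _ sub]])
  moreover have "q \<in> frac_ideal_inverse (norm_ideal (lat a c d)) \<longleftrightarrow> norm_ideal (lat a c d) \<subseteq> {x. q * x \<in> \<int>}"
    by (simp only: frac_ideal_inverse_def mem_Collect_eq subset_iff Ball_def)
  ultimately have "q \<in> frac_ideal_inverse (norm_ideal (lat a c d)) \<longleftrightarrow> (\<forall>v\<in>lat a c d. q * Qform v \<in> \<int>)"
    by (simp only: image_subset_iff mem_Collect_eq)
  also have "\<dots> \<longleftrightarrow> (\<forall>x y. q * ((a * of_int x + c * of_int y) * (d * of_int y)) \<in> \<int>)"
  proof -
    have "(\<forall>v\<in>lat a c d. P v) \<longleftrightarrow> (\<forall>x y. P (vector [a * of_int x + c * of_int y, d * of_int y]))" for P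
      unfolding lat_def by blast
    then show ?thesis by (simp only: Qform_def vector_2)
  qed
  also have "\<dots> \<longleftrightarrow> q * (a * d) \<in> \<int> \<and> q * (c * d) \<in> \<int>"
  proof
    assume h: "\<forall>x y. q * ((a * of_int x + c * of_int y) * (d * of_int y)) \<in> \<int>"
    from h[rule_format, of 0 1] have "q * (c * d) \<in> \<int>" by simp
    moreover from h[rule_format, of 1 1] have "q * (a * d) + q * (c * d) \<in> \<int>" by (simp add: algebra_simps)
    ultimately show "q * (a * d) \<in> \<int> \<and> q * (c * d) \<in> \<int>" by (metis add_in_Ints_iff_right)
  next
    assume h: "q * (a * d) \<in> \<int> \<and> q * (c * d) \<in> \<int>"
    show "\<forall>x y. q * ((a * of_int x + c * of_int y) * (d * of_int y)) \<in> \<int>"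
    proof (intro allI)
      fix x y :: int
      have "q * ((a * of_int x + c * of_int y) * (d * of_int y))
        = q * (a * d) * of_int (x * y) + q * (c * d) * of_int (y * y)" by (simp add: algebra_simps)
      then show "q * ((a * of_int x + c * of_int y) * (d * of_int y)) \<in> \<int>" using h by simp
    qed
  qed
  finally show ?thesis .
qed

text \<open>
  Multiplying the inverse ideal by the index \<open>a d\<close> gives the integers \<open>k\<close> with \<open>k c / a\<close> integral, that is, the
  multiples of the order of the slope.
\<close>

lemma order_mod_Ints_from_norm_ideal:
  assumes ad: "a > 0" "d > 0" and idx: "of_nat N = a * d"
    and B: "{of_nat B * of_int k | k. True} = {of_nat N * q | q. q \<in> frac_ideal_inverse (norm_ideal (lat a c d))}"
  shows "order_mod_Ints (c / a) B"
  unfolding order_mod_Ints_def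
proof
  fix k :: int
  have "of_int k * (c / a) \<in> \<int> \<longleftrightarrow> of_int k / (a * d) \<in> frac_ideal_inverse (norm_ideal (lat a c d))"
    unfolding frac_ideal_inverse_norm_ideal_lat using ad by simp
  also have "\<dots> \<longleftrightarrow> of_int k \<in> {of_nat N * q | q. q \<in> frac_ideal_inverse (norm_ideal (lat a c d))}"
  proof
    assume "of_int k / (a * d) \<in> frac_ideal_inverse (norm_ideal (lat a c d))"
    moreover have "of_int k = of_nat N * (of_int k / (a * d))" using ad by (simp add: idx)
    ultimately show "of_int k \<in> {of_nat N * q | q. q \<in> frac_ideal_inverse (norm_ideal (lat a c d))}" by blast
  next
    assume "of_int k \<in> {of_nat N * q | q. q \<in> frac_ideal_inverse (norm_ideal (lat a c d))}"
    then obtain q where "of_int k = of_nat N * q" "q \<in> frac_ideal_inverse (norm_ideal (lat a c d))" by blast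
    moreover from this have "of_int k / (a * d) = q" using ad by (simp add: idx)
    ultimately show "of_int k / (a * d) \<in> frac_ideal_inverse (norm_ideal (lat a c d))" by simp
  qed
  also have "\<dots> \<longleftrightarrow> (\<exists>j. (of_int k :: rat) = of_nat B * of_int j)" unfolding B[symmetric] by simp
  also have "\<dots> \<longleftrightarrow> int B dvd k"
  proof -
    have "(of_int k :: rat) = of_nat B * of_int j \<longleftrightarrow> k = int B * j" for j
      by (metis of_int_eq_iff of_int_mult of_int_of_nat_eq)
    then show ?thesis by (simp add: dvd_def)
  qed
  finally show "of_int k * (c / a) \<in> \<int> \<longleftrightarrow> int B dvd k" .
qed

section \<open>Sorting slopes by the order of the common multiple\<close>

lemma slopes_cong:
  assumes "\<theta> - \<theta>' \<in> \<int>"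
  shows "slopes b m \<theta> = slopes b m \<theta>'"
proof -
  have "of_nat a * x - of_nat d * \<theta> \<in> \<int> \<longleftrightarrow> of_nat a * x - of_nat d * \<theta>' \<in> \<int>" for a d x
  proof -
    have "of_nat a * x - of_nat d * \<theta>' = of_nat d * (\<theta> - \<theta>') + (of_nat a * x - of_nat d * \<theta>)"
      by (simp add: algebra_simps)
    moreover have "of_nat d * (\<theta> - \<theta>') \<in> \<int>" using assms by simp
    ultimately show ?thesis by (metis add_in_Ints_iff_left)
  qed
  then show ?thesis by (simp add: slopes_def)
qed

lemma finite_slopes:
  assumes "order_mod_Ints \<theta> N" "m > 0"
  shows "finite (slopes b m \<theta>)"
proof -
  have N: "N > 0" using assms(1) order_mod_Ints_pos by blast
  have "slopes b m \<theta> \<subseteq> (\<lambda>j. of_int j / of_nat (m * N)) ` {0..int (m * N)}"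
  proof
    fix x assume "x \<in> slopes b m \<theta>"
    then obtain a d where x: "0 \<le> x" "x < 1" "a * d = m" "of_nat a * x - of_nat d * \<theta> \<in> \<int>"
      unfolding slopes_def by blast
    \<comment> \<open>All solutions have denominator dividing \<open>m N\<close>: multiply \<open>a x - d \<theta>\<close> by \<open>d N\<close>.\<close>
    have "of_int (int N) * \<theta> \<in> \<int>" 
      using assms(1)[unfolded order_mod_Ints_def, rule_format, of "int N"] by simp
    then have "of_nat (d * d) * (of_int (int N) * \<theta>) \<in> \<int>" by simp
    moreover have "of_nat (d * N) * (of_nat a * x - of_nat d * \<theta>) \<in> \<int>" using x(4) by simp
    ultimately have "of_nat (d * N) * (of_nat a * x - of_nat d * \<theta>) + of_nat (d * d) * (of_int (int N) * \<theta>) \<in> \<int>"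
      by (rule Ints_add[rotated])
    also have "of_nat (d * N) * (of_nat a * x - of_nat d * \<theta>) + of_nat (d * d) * (of_int (int N) * \<theta>)
       = of_nat (m * N) * x" unfolding x(3)[symmetric] by (simp add: algebra_simps)
    finally obtain j where j: "of_nat (m * N) * x = of_int j" by (auto elim: Ints_cases)
    have pos: "(of_nat (m * N) :: rat) > 0" using N assms(2) by simp
    have xj: "x = of_int j / of_nat (m * N)" using j pos
      by (metis nonzero_mult_div_cancel_left less_irrefl)
    have "0 \<le> (of_int j :: rat)" using x(1) pos unfolding j[symmetric] by simp
    moreover have "(of_int j :: rat) < of_int (int (m * N))"
      using mult_strict_left_mono[OF x(2) pos] unfolding j by simp
    ultimately have "j \<in> {0..int (m * N)}" unfolding of_int_less_iff by simp
    then show "x \<in> (\<lambda>j. of_int j / of_nat (m * N)) ` {0..int (m * N)}" using xj by blast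
  qed
  then show ?thesis by (rule finite_subset) simp
qed

text \<open>
  Let \<open>h = gcd(N, a)\<close> and \<open>g = gcd(B, d)\<close>. Then \<open>N = b h\<close> and \<open>B = b g\<close>, while \<open>m\<close> is \<open>g h\<close> times a number prime to
  \<open>b\<close>. This expresses \<open>b\<close> through \<open>N\<close>, \<open>B\<close> and \<open>m\<close>, independently of the factorisation of \<open>m\<close>.
\<close>

lemma order_of_common_multiple:
  assumes "order_mod_Ints x N" "order_mod_Ints \<theta> B" "a * d = m" "m > 0"
    and "order_mod_Ints (of_nat a * x) b" "order_mod_Ints (of_nat d * \<theta>) b"
  shows "b\<^sup>2 * gcd (B * N) m = B * N"
proof -
  have pos: "N > 0" "B > 0" using assms order_mod_Ints_pos by blast+
  obtain N' a' where d: "N = N' * gcd N a" "a = a' * gcd N a" "coprime N' a'"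
    using gcd_coprime_exists[of N a] pos by auto
  obtain B' d' where e: "B = B' * gcd B d" "d = d' * gcd B d" "coprime B' d'"
    using gcd_coprime_exists[of B d] pos by auto
  define g h where "g = gcd N a" and "h = gcd B d"
  have gh: "g > 0" "h > 0" using pos by (simp_all add: g_def h_def)
  have d': "N = N' * g" "a = a' * g" and e': "B = B' * h" "d = d' * h"
    using d e by (simp_all only: g_def h_def)
  have "b = N div g" "b = B div h"
    using order_mod_Ints_mult[OF assms(1) pos(1), of a] order_mod_Ints_mult[OF assms(2) pos(2), of d]
      assms(5,6) order_mod_Ints_unique unfolding g_def h_def by blast+
  then have b: "N' = b" "B' = b" using d' e' gh by simp_all
  have "coprime (b\<^sup>2) (a' * d')" using d(3) e(3) b by simp
  then have "gcd (g * h * b\<^sup>2) (g * h * (a' * d')) = g * h"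
    by (subst gcd_mult_left) simp
  moreover have "B * N = g * h * b\<^sup>2" unfolding d' e' b by (simp add: power2_eq_square)
  moreover have "m = g * h * (a' * d')" unfolding assms(3)[symmetric] by (subst d'(2), subst e'(2)) simp
  ultimately show ?thesis by (simp add: mult_ac)
qed

lemma order_in_slopes:
  assumes "order_mod_Ints \<tau> b" "a * d = M" "coprime d b" "of_nat a * x - of_nat d * \<tau> \<in> \<int>"
  shows "order_mod_Ints (of_nat a * x) b" "order_mod_Ints (of_nat d * \<tau>) b"
proof -
  have "gcd b d = 1" using assms(3) by (simp add: coprime_commute)
  then show "order_mod_Ints (of_nat d * \<tau>) b"
    using order_mod_Ints_mult[OF assms(1) order_mod_Ints_pos[OF assms(1)], of d] by simp
  then show "order_mod_Ints (of_nat a * x) b" using order_mod_Ints_cong[OF assms(4)] by blast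
qed

text \<open>
  Given a factorisation \<open>m = a d\<close>, the piece is the one with \<open>B / b = gcd(B, d)\<close>.
\<close>

lemma slopes_decomposition:
  assumes "order_mod_Ints \<theta> B" "m > 0"
  shows "slopes 1 m \<theta> =
    (\<Union>b\<in>{b. b dvd B \<and> B div b dvd m}. slopes b (m div (B div b)) (of_nat (B div b) * \<theta>))"
    (is "_ = \<Union>(?F ` ?I)")
proof (intro equalityI subsetI)
  fix x assume "x \<in> slopes 1 m \<theta>"
  then obtain a d where x: "0 \<le> x" "x < 1" "a * d = m" "of_nat a * x - of_nat d * \<theta> \<in> \<int>"
    unfolding slopes_def by blast
  have B: "B > 0" using assms order_mod_Ints_pos by blast
  obtain b d' where bd: "B = b * gcd B d" "d = d' * gcd B d" "coprime b d'"
    using gcd_coprime_exists[of B d] B by auto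
  define e where "e = gcd B d"
  have e0: "e > 0" using B by (simp add: e_def)
  have bd': "B = b * e" "d = d' * e" using bd by (simp_all only: e_def)
  have b: "b > 0" using bd' B by auto
  have Bb: "B div b = e" using bd' b by simp
  have m: "m = (a * d') * e" using x(3) bd'(2) by (simp add: mult_ac)
  have "b \<in> ?I" using Bb bd'(1) m by simp
  moreover have "x \<in> ?F b"
    unfolding slopes_def Bb
  proof (intro CollectI conjI exI)
    show "a * d' = m div e" using m e0 by simp
    show "coprime d' b" using bd(3) by (simp add: coprime_commute)
    show "of_nat a * x - of_nat d' * (of_nat e * \<theta>) \<in> \<int>" using x(4) bd'(2) by (simp add: mult_ac)
  qed (use x in auto)
  ultimately show "x \<in> \<Union>(?F ` ?I)" by blast
next
  fix x assume "x \<in> \<Union>(?F ` ?I)"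
  then obtain b where b: "b dvd B" "B div b dvd m" and xb: "x \<in> ?F b" by blast
  define e where "e = B div b"
  obtain a d where x: "0 \<le> x" "x < 1" "a * d = m div e" "of_nat a * x - of_nat d * (of_nat e * \<theta>) \<in> \<int>"
    using xb unfolding slopes_def e_def by blast
  show "x \<in> slopes 1 m \<theta>"
    unfolding slopes_def
  proof (intro CollectI conjI exI)
    show "a * (d * e) = m" using x(3) b(2) by (simp add: e_def mult.assoc[symmetric])
    show "of_nat a * x - of_nat (d * e) * \<theta> \<in> \<int>" using x(4) by (simp add: mult_ac)
  qed (use x in auto)
qed

lemma order_mod_Ints_cofactor:
  assumes "order_mod_Ints \<theta> B" "b dvd B"
  shows "order_mod_Ints (of_nat (B div b) * \<theta>) b"
proof -
  have B: "B > 0" using assms order_mod_Ints_pos by blast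
  have "gcd B (B div b) = B div b" using assms(2) by (metis dvd_div_mult_self dvd_triv_left gcd_nat.absorb2)
  moreover have "B div (B div b) = b" using assms(2) B by auto
  ultimately show ?thesis using order_mod_Ints_mult[OF assms(1) B, of "B div b"] by simp
qed

text \<open>
  The order \<open>b\<close> of \<open>a x\<close> is recovered from \<open>x\<close> by \<open>order_of_common_multiple\<close>.
\<close>

lemma slopes_disjoint:
  assumes "order_mod_Ints \<theta> B" "m > 0"
    and "b dvd B" "B div b dvd m" "b' dvd B" "B div b' dvd m"
    and "x \<in> slopes b (m div (B div b)) (of_nat (B div b) * \<theta>)"
    and "x \<in> slopes b' (m div (B div b')) (of_nat (B div b') * \<theta>)"
  shows "b = b'"
proof -
  obtain N where N: "order_mod_Ints x N" "N > 0" using order_mod_Ints_exists by blast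
  have B: "B > 0" using assms order_mod_Ints_pos by blast
  have key: "c\<^sup>2 * gcd (B * N) m = B * N"
    if c: "c dvd B" "B div c dvd m" "x \<in> slopes c (m div (B div c)) (of_nat (B div c) * \<theta>)" for c
  proof -
    define e where "e = B div c"
    obtain a d where x: "a * d = m div e" "coprime d c" "of_nat a * x - of_nat d * (of_nat e * \<theta>) \<in> \<int>"
      using c(3) unfolding slopes_def e_def by blast
    note o = order_in_slopes[OF order_mod_Ints_cofactor[OF assms(1) c(1), folded e_def] x]
    have "a * (d * e) = m" using x(1) c(2) by (simp add: e_def mult.assoc[symmetric])
    moreover have "of_nat d * (of_nat e * \<theta>) = of_nat (d * e) * \<theta>" by simp
    ultimately show ?thesis
      using order_of_common_multiple[OF N(1) assms(1) _ assms(2) o(1)] o(2) by metis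
  qed
  have "b\<^sup>2 * gcd (B * N) m = b'\<^sup>2 * gcd (B * N) m" using key[of b] key[of b'] assms by simp
  then have "b\<^sup>2 = b'\<^sup>2" using assms(2) by simp
  then show "b = b'" by simp
qed

section \<open>Counting the slopes of a given order\<close>

lemma card_coprime_below:
  assumes "n > 0"
  shows "card {i. i < n \<and> coprime i n} = totient n"
proof (cases "n = 1")
  case True
  have "{i :: nat. i < 1 \<and> coprime i 1} = {0}" by auto
  then show ?thesis unfolding True by (metis card_1_singleton_iff One_nat_def totient_1)
next
  case False
  then have n: "n > 1" using assms by linarith
  have "i < n \<and> coprime i n \<longleftrightarrow> 0 < i \<and> i \<le> n \<and> coprime i n" for i
  proof (cases "i = 0 \<or> i = n")
    case True
    then have "\<not> coprime i n" using n by (elim disjE) simp_all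
    then show ?thesis by blast
  next
    case False
    then show ?thesis by linarith
  qed
  then have "{i. i < n \<and> coprime i n} = totatives n"
    unfolding totatives_def by (simp only: greaterThanAtMost_iff conj_assoc mem_Collect_eq)
  then show ?thesis by (simp only: totient_def)
qed

text \<open>
  Chinese remainder theorem: the residue modulo \<open>b\<close> is chosen in \<open>S\<close>, the one modulo \<open>n\<close> among the units.
\<close>

lemma card_lifts_of_residues:
  fixes b n :: nat
  assumes "coprime b n" "b > 0" "n > 0" "S \<subseteq> {..<b}"
  shows "card {j. j < b * n \<and> coprime j n \<and> j mod b \<in> S} = card S * totient n" (is "card ?J = _")
proof -
  have "bij_betw (\<lambda>j. (j mod b, j mod n)) ?J (S \<times> {i. i < n \<and> coprime i n})"
    unfolding bij_betw_def
  proof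
    show "inj_on (\<lambda>j. (j mod b, j mod n)) ?J"
    proof (intro inj_onI)
      fix i j assume ij: "i \<in> ?J" "j \<in> ?J" "(i mod b, i mod n) = (j mod b, j mod n)"
      then have "[i = j] (mod (b * n))"
        using coprime_cong_mult_nat[of i j b n] assms(1) by (simp add: cong_def)
      then show "i = j" using ij by (simp add: cong_def)
    qed
    show "(\<lambda>j. (j mod b, j mod n)) ` ?J = S \<times> {i. i < n \<and> coprime i n}"
    proof (intro equalityI subsetI)
      fix p assume "p \<in> (\<lambda>j. (j mod b, j mod n)) ` ?J"
      then show "p \<in> S \<times> {i. i < n \<and> coprime i n}" using assms by (auto simp: coprime_commute)
    next
      fix p assume "p \<in> S \<times> {i. i < n \<and> coprime i n}"
      then obtain w i where p: "p = (w, i)" "w \<in> S" "w < b" "i < n" "coprime i n"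
        using assms(4) by auto
      obtain j where j: "j < b * n" "[j = w] (mod b)" "[j = i] (mod n)"
        using binary_chinese_remainder_unique_nat[OF assms(1), of w i] assms by auto
      have jj: "j mod b = w" "j mod n = i" using j p by (simp_all add: cong_def)
      then have "coprime (j mod n) n" using p by simp
      then have "coprime j n" using assms(3) by (simp add: coprime_commute)
      then show "p \<in> (\<lambda>j. (j mod b, j mod n)) ` ?J" using jj j(1) p(1,2) by (intro image_eqI[of _ _ j]) simp_all
    qed
  qed
  from bij_betw_same_card[OF this] show ?thesis
    by (simp add: card_cartesian_product card_coprime_below[OF assms(3)])
qed

text \<open>
  The residues \<open>w = d\<^sup>2 t / k\<close> are the squares \<open>d\<^sup>2\<close> multiplied by the fixed unit \<open>t / k\<close>. Divisors \<open>d\<close> of \<open>k\<close> are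
  automatically prime to \<open>b\<close>. In the proof both sets are mapped to the set of all \<open>d\<^sup>2 t\<close>.
\<close>

lemma card_square_ratio_residues:
  fixes b k t :: nat
  assumes "b > 0" "coprime k b" "coprime t b"
  shows "card {w. w < b \<and> (\<exists>d. d dvd k \<and> [k * w = d\<^sup>2 * t] (mod b))} = num_square_residues b k"
    (is "card ?S = _")
proof -
  let ?R = "{d\<^sup>2 mod b | d. d dvd k \<and> coprime d b}"
  have img: "(\<lambda>w. k * w mod b) ` ?S = (\<lambda>r. r * t mod b) ` ?R"
  proof (intro equalityI subsetI)
    fix y assume "y \<in> (\<lambda>w. k * w mod b) ` ?S"
    then obtain w d where w: "y = k * w mod b" "d dvd k" "[k * w = d\<^sup>2 * t] (mod b)" by blast
    have "coprime d b" using coprime_divisors[OF w(2) dvd_refl assms(2)] .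
    then have "d\<^sup>2 mod b \<in> ?R" using w by blast
    moreover have "y = (d\<^sup>2 mod b) * t mod b" using w by (simp add: cong_def mod_mult_left_eq)
    ultimately show "y \<in> (\<lambda>r. r * t mod b) ` ?R" by blast
  next
    fix y assume "y \<in> (\<lambda>r. r * t mod b) ` ?R"
    then obtain d where d: "y = (d\<^sup>2 mod b) * t mod b" "d dvd k" by blast
    obtain u where u: "[k * u = 1] (mod b)" using cong_solve_coprime_nat[OF assms(2)] by auto
    define w where "w = u * (d\<^sup>2 * t) mod b"
    have "[k * w = k * u * (d\<^sup>2 * t)] (mod b)" by (simp add: w_def cong_def mod_mult_right_eq mult_ac)
    also have "[k * u * (d\<^sup>2 * t) = 1 * (d\<^sup>2 * t)] (mod b)" using u by (intro cong_mult cong_refl)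
    finally have kw: "[k * w = d\<^sup>2 * t] (mod b)" by simp
    then have "w \<in> ?S" using d assms(1) by (auto simp: w_def)
    moreover have "y = k * w mod b" using kw d by (simp add: cong_def mod_mult_left_eq)
    ultimately show "y \<in> (\<lambda>w. k * w mod b) ` ?S" by blast
  qed
  have injS: "inj_on (\<lambda>w. k * w mod b) ?S"
  proof (intro inj_onI)
    fix v w assume vw: "v \<in> ?S" "w \<in> ?S" "k * v mod b = k * w mod b"
    then have "v < b" "w < b" by blast+
    moreover have "[v = w] (mod b)"
      using vw(3) cong_mult_lcancel_nat[OF assms(2), of v w] unfolding cong_def by blast
    ultimately show "v = w" by (simp add: cong_def)
  qed
  have injR: "inj_on (\<lambda>r. r * t mod b) ?R"
  proof (intro inj_onI)
    fix v w assume vw: "v \<in> ?R" "w \<in> ?R" "v * t mod b = w * t mod b"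
    have "?R \<subseteq> {..<b}" using assms(1) by auto
    then have "v < b" "w < b" using vw(1,2) by blast+
    moreover have "[v = w] (mod b)"
      using vw(3) cong_mult_rcancel_nat[OF assms(3), of v w] unfolding cong_def by blast
    ultimately show "v = w" by (simp add: cong_def)
  qed
  show ?thesis
    unfolding num_square_residues_def card_image[OF injS, symmetric] img card_image[OF injR] ..
qed

lemma divide_diff_in_Ints_iff_cong:
  assumes "b > 0"
  shows "(of_nat i / of_nat b - of_nat j / of_nat b :: rat) \<in> \<int> \<longleftrightarrow> [i = j] (mod b)"
proof -
  have "(of_nat i / of_nat b - of_nat j / of_nat b :: rat) = of_int (int i - int j) / of_nat b"
    by (simp add: diff_divide_distrib)
  then show ?thesis
    using of_int_divide_in_Ints_iff_rat[OF assms, of "int i - int j"]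
    by (metis cong_iff_dvd_diff cong_int_iff)
qed

text \<open>
  Let \<open>x = j / (b n)\<close> in lowest terms be a solution for \<open>M = a d\<close>. Then \<open>n\<close> divides \<open>a\<close>, and with \<open>a = n a1\<close> the
  condition becomes \<open>a1 j = d t\<close> modulo \<open>b\<close>. Multiplication by the unit \<open>d\<close> turns it into
  \<open>(M / n) j = d\<^sup>2 t\<close>, which no longer involves \<open>a1\<close>.
\<close>

lemma slopes_coprime_eq:
  assumes "b > 0" "coprime t b" "M > 0" "coprime M b"
  shows "slopes b M (of_nat t / of_nat b) =
    (\<Union>n\<in>{n. n dvd M}. (\<lambda>j. of_nat j / of_nat (b * n)) `
      {j. j < b * n \<and> coprime j n \<and>
        j mod b \<in> {w. w < b \<and> (\<exists>d. d dvd M div n \<and> [M div n * w = d\<^sup>2 * t] (mod b))}})"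
    (is "?L = ?R")
proof (intro equalityI subsetI)
  fix x :: rat assume "x \<in> ?L"
  then obtain a d where x: "0 \<le> x" "x < 1" "a * d = M" "coprime d b"
    "of_nat a * x - of_nat d * (of_nat t / of_nat b) \<in> \<int>"
    unfolding slopes_def by blast
  obtain j N where j: "N > 0" "j < N" "coprime j N" "x = of_nat j / of_nat N"
    using unit_interval_fraction x by blast
  have oN: "order_mod_Ints x N" using order_mod_Ints_fraction j by blast
  have "order_mod_Ints (of_nat a * x) b"
    using order_in_slopes(1)[OF order_mod_Ints_fraction[OF assms(2,1)] x(3-5)] .
  then have bN: "N div gcd N a = b" using order_mod_Ints_mult[OF oN j(1), of a] order_mod_Ints_unique by blast
  define n where "n = gcd N a"
  have n0: "n > 0" using j by (simp add: n_def)
  have N: "N = b * n" using bN by (metis dvd_div_mult_self gcd_dvd1 n_def)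
  obtain a1 where a: "a = n * a1" by (metis dvdE gcd_dvd2 n_def)
  have nM: "n dvd M" using a x(3) by auto
  have k: "M div n = a1 * d" using a x(3) n0 by (metis mult.assoc nonzero_mult_div_cancel_left less_irrefl)
  have "of_nat a * x - of_nat d * (of_nat t / of_nat b) = (of_nat (a1 * j) / of_nat b - of_nat (d * t) / of_nat b :: rat)"
    using n0 assms(1) by (simp add: a j(4) N)
  then have c: "[a1 * j = d * t] (mod b)" using x(5) divide_diff_in_Ints_iff_cong[OF assms(1)] by metis
  have "[M div n * (j mod b) = M div n * j] (mod b)" by (simp add: cong_def mod_mult_right_eq)
  also have "M div n * j = d * (a1 * j)" unfolding k by simp
  also have "[d * (a1 * j) = d * (d * t)] (mod b)" using cong_scalar_left[OF c] .
  finally have c2: "[M div n * (j mod b) = d\<^sup>2 * t] (mod b)" by (simp add: power2_eq_square mult_ac)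
  show "x \<in> ?R"
  proof (intro UN_I image_eqI)
    show "n \<in> {n. n dvd M}" using nM by simp
    show "x = of_nat j / of_nat (b * n)" using j(4) N by simp
    have "\<exists>d. d dvd M div n \<and> [M div n * (j mod b) = d\<^sup>2 * t] (mod b)"
      using c2 k by (intro exI[of _ d]) simp
    moreover have "coprime j n" using j(3) N by simp
    ultimately show "j \<in> {j. j < b * n \<and> coprime j n \<and>
        j mod b \<in> {w. w < b \<and> (\<exists>d. d dvd M div n \<and> [M div n * w = d\<^sup>2 * t] (mod b))}}"
      using j(2) N assms(1) by simp
  qed
next
  fix x :: rat assume "x \<in> ?R"
  then obtain n j d where n: "n dvd M" "x = of_nat j / of_nat (b * n)" "j < b * n" "coprime j n"
    "d dvd M div n" "[M div n * (j mod b) = d\<^sup>2 * t] (mod b)" by blast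
  have n0: "n > 0" using n(1) assms(3) by (auto intro: Nat.gr0I)
  obtain a where a: "M div n = d * a" using n(5) by (elim dvdE)
  have M: "M = n * a * d" using n(1) a by (metis dvd_mult_div_cancel mult.assoc mult.commute)
  have d: "coprime d b" using assms(4) M by simp
  have "[d * a * j = d * a * (j mod b)] (mod b)" by (simp add: cong_def mod_mult_right_eq)
  also have "[d * a * (j mod b) = d * (d * t)] (mod b)" using n(6) a by (simp add: power2_eq_square mult_ac)
  finally have "[d * (a * j) = d * (d * t)] (mod b)" by (simp add: mult.assoc)
  then have c: "[a * j = d * t] (mod b)" using cong_mult_lcancel_nat[OF d] by blast
  show "x \<in> ?L"
    unfolding slopes_def
  proof (intro CollectI conjI exI)
    show "n * a * d = M" using M by simp
    show "coprime d b" by fact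
    have "of_nat (n * a) * x - of_nat d * (of_nat t / of_nat b) = (of_nat (a * j) / of_nat b - of_nat (d * t) / of_nat b :: rat)"
      using n0 assms(1) by (simp add: n(2))
    then show "of_nat (n * a) * x - of_nat d * (of_nat t / of_nat b) \<in> \<int>"
      using c divide_diff_in_Ints_iff_cong[OF assms(1)] by metis
    show "x < 1" using n(2,3) by (simp add: divide_less_eq flip: of_nat_mult)
  qed (use n in auto)
qed

text \<open>
  The pieces of \<open>slopes_coprime_eq\<close> are disjoint because the elements of the \<open>n\<close>-th one have order \<open>b n\<close>.
\<close>

lemma card_slopes_coprime:
  assumes "order_mod_Ints \<tau> b" "M > 0" "coprime M b"
  shows "card (slopes b M \<tau>) = (\<Sum>n | n dvd M. totient n * num_square_residues b (M div n))"
proof -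
  obtain t where t: "b > 0" "coprime t b" "\<tau> - of_nat t / of_nat b \<in> \<int>"
    using order_mod_Ints_representative[OF assms(1)] by blast
  define S where "S k = {w. w < b \<and> (\<exists>d. d dvd k \<and> [k * w = d\<^sup>2 * t] (mod b))}" for k
  define J where "J n = {j. j < b * n \<and> coprime j n \<and> j mod b \<in> S (M div n)}" for n
  define F where "F n = (\<lambda>j. of_nat j / of_nat (b * n) :: rat) ` J n" for n
  have sl: "slopes b M \<tau> = (\<Union>n\<in>{n. n dvd M}. F n)"
    unfolding slopes_cong[OF t(3)] slopes_coprime_eq[OF t(1,2) assms(2,3)] F_def J_def S_def ..
  have fin: "finite {n. n dvd M}" using assms(2) by simp
  have pos: "n > 0" if "n dvd M" for n using that assms(2) by (auto intro: Nat.gr0I)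
  have finJ: "finite (J n)" for n by (rule finite_subset[of _ "{..<b*n}"]) (auto simp: J_def)
  have ord: "order_mod_Ints x (b * n)" if nx: "n dvd M" "x \<in> F n" for n x
  proof -
    obtain j where j: "x = of_nat j / of_nat (b * n)" "coprime j n" "j mod b \<in> S (M div n)"
      using nx(2) unfolding F_def J_def by blast
    obtain d where d: "d dvd M div n" "[M div n * (j mod b) = d\<^sup>2 * t] (mod b)" using j(3) by (auto simp: S_def)
    have "d dvd M" using d(1) nx(1) by (metis dvd_mult dvd_mult_div_cancel)
    then have "coprime (d\<^sup>2 * t) b" using coprime_divisors[OF _ dvd_refl assms(3)] t(2) by simp
    then have "coprime (M div n * (j mod b)) b" using d(2) cong_imp_coprime cong_sym by blast
    then have "coprime (j mod b) b" by simp
    then have "coprime j b" using t(1) by (simp add: coprime_commute)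
    then show ?thesis using j order_mod_Ints_fraction[of j "b * n"] t(1) pos[OF nx(1)] by simp
  qed
  have disj: "F n \<inter> F n' = {}" if "n dvd M" "n' dvd M" "n \<noteq> n'" for n n'
  proof -
    have False if "x \<in> F n" "x \<in> F n'" for x
      using ord[of n x] ord[of n' x] order_mod_Ints_unique that \<open>n dvd M\<close> \<open>n' dvd M\<close> \<open>n \<noteq> n'\<close> t(1)
      by (metis mult_cancel1 less_irrefl)
    then show ?thesis by blast
  qed
  have "card (F n) = totient n * num_square_residues b (M div n)" if n: "n dvd M" for n
  proof -
    have "inj_on (\<lambda>j. of_nat j / of_nat (b * n) :: rat) (J n)"
      using t(1) pos[OF n] by (auto simp: inj_on_def)
    then have "card (F n) = card (J n)" unfolding F_def by (rule card_image)
    also have "\<dots> = card (S (M div n)) * totient n"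
      unfolding J_def
    proof (rule card_lifts_of_residues)
      show "coprime b n" using coprime_divisors[OF n dvd_refl assms(3)] by (simp add: coprime_commute)
    qed (use t pos[OF n] in \<open>auto simp: S_def\<close>)
    also have "card (S (M div n)) = num_square_residues b (M div n)"
      unfolding S_def
    proof (rule card_square_ratio_residues)
      show "coprime (M div n) b" using n assms(3) by (metis coprime_mult_left_iff dvd_mult_div_cancel)
    qed (use t in auto)
    finally show ?thesis by simp
  qed
  then show ?thesis
    unfolding sl by (subst card_UN_disjoint) (use fin finJ disj in \<open>auto simp: F_def\<close>)
qed

text \<open>
  As \<open>d\<close> is prime to \<open>b\<close>, hence to \<open>M0\<close>, the factor \<open>M0\<close> divides \<open>a\<close>. So \<open>x\<close> is a solution for \<open>M0 M1\<close> if and only if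
  \<open>M0 x\<close> is one for \<open>M1\<close>, and every class in \<open>\<rat>/\<int>\<close> has \<open>M0\<close> preimages under multiplication by \<open>M0\<close>. The
  hypothesis on \<open>M0\<close> states that its prime factors divide \<open>b\<close>.
\<close>

lemma card_slopes_mult:
  assumes "order_mod_Ints \<tau> b" "M0 > 0" "M1 > 0" "\<And>d. coprime d b \<Longrightarrow> coprime d M0"
  shows "card (slopes b (M0 * M1) \<tau>) = M0 * card (slopes b M1 \<tau>)"
proof -
  have iff: "x \<in> slopes b (M0 * M1) \<tau> \<longleftrightarrow> frac (of_nat M0 * x) \<in> slopes b M1 \<tau>" if x01: "0 \<le> x" "x < 1" for x
  proof -
    have *: "of_nat (M0 * a) * x - of_nat d * \<tau> \<in> \<int> \<longleftrightarrow> of_nat a * frac (of_nat M0 * x) - of_nat d * \<tau> \<in> \<int>" for a d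
    proof -
      have "of_nat (M0 * a) * x - of_nat d * \<tau>
         = of_nat a * of_int \<lfloor>of_nat M0 * x\<rfloor> + (of_nat a * frac (of_nat M0 * x) - of_nat d * \<tau>)"
        by (simp add: frac_def algebra_simps)
      moreover have "of_nat a * of_int \<lfloor>of_nat M0 * x\<rfloor> \<in> (\<int> :: rat set)" by simp
      ultimately show ?thesis by (metis add_in_Ints_iff_left)
    qed
    have "(\<exists>a d. a * d = M0 * M1 \<and> coprime d b \<and> of_nat a * x - of_nat d * \<tau> \<in> \<int>)
       \<longleftrightarrow> (\<exists>a d. a * d = M1 \<and> coprime d b \<and> of_nat a * frac (of_nat M0 * x) - of_nat d * \<tau> \<in> \<int>)"
    proof
      assume "\<exists>a d. a * d = M0 * M1 \<and> coprime d b \<and> of_nat a * x - of_nat d * \<tau> \<in> \<int>"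
      then obtain a d where ad: "a * d = M0 * M1" "coprime d b" "of_nat a * x - of_nat d * \<tau> \<in> \<int>" by blast
      have "M0 dvd a * d" using ad(1) by simp
      then have "M0 dvd a" using assms(4)[OF ad(2)] by (simp add: coprime_commute coprime_dvd_mult_left_iff)
      then obtain a' where a': "a = M0 * a'" by (elim dvdE)
      then have "a' * d = M1" using ad(1) assms(2) by simp
      then show "\<exists>a d. a * d = M1 \<and> coprime d b \<and> of_nat a * frac (of_nat M0 * x) - of_nat d * \<tau> \<in> \<int>"
        using ad * a' by blast
    next
      assume "\<exists>a d. a * d = M1 \<and> coprime d b \<and> of_nat a * frac (of_nat M0 * x) - of_nat d * \<tau> \<in> \<int>"
      then show "\<exists>a d. a * d = M0 * M1 \<and> coprime d b \<and> of_nat a * x - of_nat d * \<tau> \<in> \<int>"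
        using * by (metis mult.assoc)
    qed
    then show ?thesis using x01 by (simp add: slopes_def frac_lt_1)
  qed
  have M0r: "(of_nat M0 :: rat) > 0" using assms(2) by simp
  let ?f = "\<lambda>(i, y). (of_nat i + y) / of_nat M0 :: rat"
  \<comment> \<open>The preimages of \<open>y\<close> are \<open>(i + y) / M0\<close>.\<close>
  have "bij_betw ?f ({..<M0} \<times> slopes b M1 \<tau>) (slopes b (M0 * M1) \<tau>)"
    unfolding bij_betw_def
  proof
    show "inj_on ?f ({..<M0} \<times> slopes b M1 \<tau>)"
    proof (intro inj_onI, clarify)
      fix i i' y y'
      assume y: "y \<in> slopes b M1 \<tau>" "y' \<in> slopes b M1 \<tau>"
        and "(of_nat i + y) / of_nat M0 = (of_nat i' + y') / of_nat M0"
      then have eq: "of_nat i + y = of_nat i' + y'" using M0r by simp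
      have r: "0 \<le> y" "y < 1" "0 \<le> y'" "y' < 1" using y unfolding slopes_def by blast+
      have "\<lfloor>of_nat i + y\<rfloor> = int i" using r by (intro floor_unique) auto
      moreover have "\<lfloor>of_nat i' + y'\<rfloor> = int i'" using r by (intro floor_unique) auto
      ultimately have "i = i'" using eq by simp
      then show "i = i' \<and> y = y'" using eq by simp
    qed
    show "?f ` ({..<M0} \<times> slopes b M1 \<tau>) = slopes b (M0 * M1) \<tau>"
    proof (intro equalityI subsetI)
      fix x assume "x \<in> ?f ` ({..<M0} \<times> slopes b M1 \<tau>)"
      then obtain i y where x: "x = (of_nat i + y) / of_nat M0" "i < M0" "y \<in> slopes b M1 \<tau>" by auto
      have r: "0 \<le> y" "y < 1" using x(3) unfolding slopes_def by blast+
      have "(of_nat i :: rat) + 1 \<le> of_nat M0" using x(2) by (metis Suc_leI of_nat_Suc of_nat_le_iff add.commute)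
      then have x01: "0 \<le> x" "x < 1" using r M0r unfolding x(1) by (simp_all add: divide_simps)
      have "of_nat M0 * x = of_nat i + y" using x M0r by simp
      then have "frac (of_nat M0 * x) = y" using r by (simp add: frac_unique_iff)
      then show "x \<in> slopes b (M0 * M1) \<tau>" using iff[OF x01] x(3) by simp
    next
      fix x assume x: "x \<in> slopes b (M0 * M1) \<tau>"
      then have x01: "0 \<le> x" "x < 1" unfolding slopes_def by blast+
      define i where "i = nat \<lfloor>of_nat M0 * x\<rfloor>"
      have i: "of_nat i = (of_int \<lfloor>of_nat M0 * x\<rfloor> :: rat)" using x01 M0r by (simp add: i_def)
      have "of_nat M0 * x < of_nat M0" using x01 M0r by simp
      then have "\<lfloor>of_nat M0 * x\<rfloor> < int M0" by (simp add: floor_less_iff)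
      then have "i < M0" using assms(2) by (simp add: i_def nat_less_iff)
      moreover have "x = (of_nat i + frac (of_nat M0 * x)) / of_nat M0" using M0r by (simp add: i frac_def)
      ultimately show "x \<in> ?f ` ({..<M0} \<times> slopes b M1 \<tau>)"
        using iff[OF x01] x by (intro image_eqI[of _ _ "(i, frac (of_nat M0 * x))"]) auto
    qed
  qed
  from bij_betw_same_card[OF this] show ?thesis by (simp add: card_cartesian_product)
qed

text \<open>
  Dividing by \<open>gcd(M, b)\<close> until it becomes one collects the primes of \<open>b\<close> in \<open>M0\<close>. That all primes of \<open>M0\<close>
  divide \<open>b\<close> is expressed by the condition that whatever is prime to \<open>b\<close> is prime to \<open>M0\<close>.
\<close>

lemma split_off_common_primes:
  fixes M b :: nat
  assumes "M > 0"
  shows "\<exists>M0 M1. M = M0 * M1 \<and> coprime M1 b \<and> (\<forall>d. coprime d b \<longrightarrow> coprime d M0)"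
  using assms
proof (induction M rule: less_induct)
  case (less M)
  show ?case
  proof (cases "coprime M b")
    case True
    then show ?thesis by (intro exI[of _ 1] exI[of _ M]) auto
  next
    case False
    define g where "g = gcd M b"
    obtain M' where M': "M = g * M'" by (metis dvdE gcd_dvd1 g_def)
    have "g \<noteq> 1" using False by (simp add: g_def coprime_iff_gcd_eq_1)
    then have "g > 1" using less.prems M' by (cases g) auto
    then have "M' < M" "M' > 0" using less.prems M' by auto
    then obtain M0 M1 where M: "M' = M0 * M1" "coprime M1 b" "\<forall>d. coprime d b \<longrightarrow> coprime d M0"
      using less.IH by blast
    have "coprime d (g * M0)" if "coprime d b" for d
      using that M(3) coprime_divisors[OF dvd_refl _ that, of g] by (simp add: g_def)
    then show ?thesis using M M' by (intro exI[of _ "g * M0"] exI[of _ M1]) auto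
  qed
qed

lemma sum_divisors_coprime_mult:
  fixes f :: "nat \<Rightarrow> nat"
  assumes "coprime m n" "m > 0" "n > 0"
  shows "(\<Sum>d | d dvd m * n. f d) = (\<Sum>d | d dvd m. \<Sum>e | e dvd n. f (d * e))"
proof -
  have "bij_betw (\<lambda>(d, e). d * e) ({d. d dvd m} \<times> {e. e dvd n}) {d. d dvd m * n}"
    unfolding bij_betw_def
  proof
    show "inj_on (\<lambda>(d, e). d * e) ({d. d dvd m} \<times> {e. e dvd n})"
    proof (intro inj_onI, clarify)
      fix d e d' e' assume d: "d dvd m" "e dvd n" "d' dvd m" "e' dvd n" "d * e = d' * e'"
      have co: "coprime d e'" "coprime d' e" 
        using coprime_divisors[OF d(1,4) assms(1)] coprime_divisors[OF d(3,2) assms(1)] .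
      have "d dvd d'" using d(5) co by (metis coprime_dvd_mult_left_iff dvd_triv_left)
      moreover have "d' dvd d" using d(5) co by (metis coprime_dvd_mult_left_iff dvd_triv_left)
      ultimately have "d = d'" by (rule dvd_antisym)
      moreover have "d > 0" using d(1) assms(2) by (auto intro: Nat.gr0I)
      ultimately show "d = d' \<and> e = e'" using d(5) by simp
    qed
    show "(\<lambda>(d, e). d * e) ` ({d. d dvd m} \<times> {e. e dvd n}) = {d. d dvd m * n}"
    proof (intro equalityI subsetI)
      fix x assume "x \<in> {d. d dvd m * n}"
      then obtain d e where "x = d * e" "d dvd m" "e dvd n" by (auto elim: dvd_productE)
      then show "x \<in> (\<lambda>(d, e). d * e) ` ({d. d dvd m} \<times> {e. e dvd n})" by force
    qed (auto intro: mult_dvd_mono)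
  qed
  from sum.reindex_bij_betw[OF this, of f] show ?thesis
    by (simp add: sum.cartesian_product case_prod_unfold)
qed

lemma num_square_residues_mult:
  assumes "\<And>d. coprime d b \<Longrightarrow> coprime d k'"
  shows "num_square_residues b (k' * k) = num_square_residues b k"
proof -
  have "d dvd k' * k \<and> coprime d b \<longleftrightarrow> d dvd k \<and> coprime d b" for d
    using assms[of d] by (auto simp: coprime_dvd_mult_right_iff)
  then show ?thesis by (simp add: num_square_residues_def)
qed

text \<open>
  In the sum over divisors \<open>n0 n\<close> of \<open>M0 M1\<close> the residue count sees only \<open>M1 / n\<close>, so the sum over \<open>n0\<close>
  is the sum of the totients of the divisors of \<open>M0\<close>.
\<close>

lemma totient_convolution_mult:
  assumes "\<And>d. coprime d b \<Longrightarrow> coprime d M0" "M0 > 0" "M1 > 0" "coprime M1 b"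
  shows "(\<Sum>n | n dvd M0 * M1. totient n * num_square_residues b (M0 * M1 div n))
       = M0 * (\<Sum>n | n dvd M1. totient n * num_square_residues b (M1 div n))"
proof -
  have co: "coprime M0 M1" using assms(1)[OF assms(4)] by (simp add: coprime_commute)
  have *: "totient (n0 * n) * num_square_residues b (M0 * M1 div (n0 * n))
     = totient n0 * (totient n * num_square_residues b (M1 div n))"
    if n: "n0 dvd M0" "n dvd M1" for n0 n
  proof -
    have "coprime n0 n" using coprime_divisors[OF n co] .
    then have "totient (n0 * n) = totient n0 * totient n" by (rule totient_mult_coprime)
    moreover have "M0 * M1 div (n0 * n) = (M0 div n0) * (M1 div n)" using n by (simp add: div_mult_div_if_dvd)
    moreover have "num_square_residues b ((M0 div n0) * (M1 div n)) = num_square_residues b (M1 div n)"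
    proof (rule num_square_residues_mult)
      fix d assume "coprime d b"
      then have "coprime d M0" by (rule assms(1))
      then show "coprime d (M0 div n0)" using n(1) by (metis coprime_mult_right_iff dvd_mult_div_cancel)
    qed
    ultimately show ?thesis by simp
  qed
  have "(\<Sum>n | n dvd M0 * M1. totient n * num_square_residues b (M0 * M1 div n))
     = (\<Sum>n0 | n0 dvd M0. \<Sum>n | n dvd M1. totient n0 * (totient n * num_square_residues b (M1 div n)))"
    unfolding sum_divisors_coprime_mult[OF co assms(2,3)] using * by (intro sum.cong) auto
  also have "\<dots> = (\<Sum>n0 | n0 dvd M0. totient n0) * (\<Sum>n | n dvd M1. totient n * num_square_residues b (M1 div n))"
    by (simp add: sum_product)
  finally show ?thesis by (simp add: totient_divisor_sum)
qed

lemma card_slopes: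
  assumes "order_mod_Ints \<tau> b" "M > 0"
  shows "card (slopes b M \<tau>) = (\<Sum>n | n dvd M. totient n * num_square_residues b (M div n))"
proof -
  obtain M0 M1 where M: "M = M0 * M1" "coprime M1 b" "\<And>d. coprime d b \<Longrightarrow> coprime d M0"
    using split_off_common_primes[OF assms(2)] by blast
  have pos: "M0 > 0" "M1 > 0" using M(1) assms(2) by auto
  show ?thesis
    using totient_convolution_mult[of b M0 M1, OF M(3) pos M(2)] card_slopes_mult[of \<tau> b M0 M1, OF assms(1) pos M(3)]
      card_slopes_coprime[OF assms(1) pos(2) M(2)] by (simp add: M(1))
qed

lemma card_slopes_total:
  assumes "order_mod_Ints \<theta> B" "m > 0"
  shows "card (slopes 1 m \<theta>) = (\<Sum>b | b dvd B. if B div b dvd m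
    then \<Sum>n | n dvd m div (B div b). totient n * num_square_residues b (m div (B div b) div n) else 0)"
proof -
  have B: "B > 0" using assms order_mod_Ints_pos by blast
  have fin: "finite {b. b dvd B}" using B by simp
  have pos: "m div (B div b) > 0" if "B div b dvd m" for b using that assms(2) by (metis dvd_div_eq_0_iff neq0_conv)
  have "card (slopes 1 m \<theta>) = (\<Sum>b | b dvd B \<and> B div b dvd m.
     card (slopes b (m div (B div b)) (of_nat (B div b) * \<theta>)))"
    unfolding slopes_decomposition[OF assms]
  proof (rule card_UN_disjoint)
    show "\<forall>i\<in>{b. b dvd B \<and> B div b dvd m}. finite (slopes i (m div (B div i)) (of_nat (B div i) * \<theta>))"
      using finite_slopes[OF order_mod_Ints_cofactor[OF assms(1)] pos] by blast
  qed (use fin slopes_disjoint[OF assms] in \<open>auto simp: conj_commute\<close>)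
  also have "\<dots> = (\<Sum>b | b dvd B \<and> B div b dvd m.
      \<Sum>n | n dvd m div (B div b). totient n * num_square_residues b (m div (B div b) div n))"
    using card_slopes[OF order_mod_Ints_cofactor[OF assms(1)] pos] by (intro sum.cong) auto
  also have "\<dots> = (\<Sum>b | b dvd B. if B div b dvd m
    then \<Sum>n | n dvd m div (B div b). totient n * num_square_residues b (m div (B div b) div n) else 0)"
    unfolding sum.inter_filter[OF fin, symmetric] by (simp only: mem_Collect_eq)
  finally show ?thesis .
qed

section \<open>Dirichlet series\<close>

definition dirichlet_conv :: "(nat \<Rightarrow> nat) \<Rightarrow> (nat \<Rightarrow> nat) \<Rightarrow> nat \<Rightarrow> nat" where
  "dirichlet_conv f g n = (\<Sum>d | d dvd n. f d * g (n div d))"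

text \<open>Summability of complex families is absolute summability, which passes to products.\<close>

lemma has_sum_Times_mult:
  fixes f :: "'a \<Rightarrow> complex" and g :: "'b \<Rightarrow> complex"
  assumes "f summable_on A" "g summable_on C"
  shows "((\<lambda>(x, y). f x * g y) has_sum (infsum f A * infsum g C)) (A \<times> C)"
proof -
  have f: "(\<lambda>x. norm (f x)) summable_on A" and g: "(\<lambda>y. norm (g y)) summable_on C"
    using assms by (simp_all add: summable_on_iff_abs_summable_on_complex[symmetric])
  have "(\<lambda>p. norm (case p of (x, y) \<Rightarrow> f x * g y)) summable_on A \<times> C"
    unfolding Infinite_Sum.abs_summable_on_Sigma_iff
  proof (intro conjI ballI)
    fix x assume "x \<in> A"
    show "(\<lambda>y. norm (case (x, y) of (x, y) \<Rightarrow> f x * g y)) summable_on C"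
      using summable_on_cmult_right[OF g, of "norm (f x)"] by (simp add: norm_mult)
  next
    have "(\<lambda>x. norm (f x) * (\<Sum>\<^sub>\<infinity>y\<in>C. norm (g y))) summable_on A"
      by (rule summable_on_cmult_left[OF f])
    moreover have "(\<Sum>\<^sub>\<infinity>y\<in>C. norm (g y)) \<ge> 0" by (rule infsum_nonneg) simp
    ultimately show "(\<lambda>x. norm (\<Sum>\<^sub>\<infinity>y\<in>C. norm (case (x, y) of (x, y) \<Rightarrow> f x * g y))) summable_on A"
      by (simp add: norm_mult infsum_cmult_right' abs_mult)
  qed
  then have sm: "(\<lambda>(x, y). f x * g y) summable_on A \<times> C" by (rule Infinite_Sum.abs_summable_summable)
  show ?thesis
  proof (rule has_sum_SigmaI[where g = "\<lambda>x. f x * infsum g C"])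
    fix x assume "x \<in> A"
    show "((\<lambda>y. case (x, y) of (x, y) \<Rightarrow> f x * g y) has_sum f x * infsum g C) C"
      using has_sum_cmult_right[OF has_sum_infsum[OF assms(2)], of "f x"] by simp
  qed (use sm has_sum_cmult_left[OF has_sum_infsum[OF assms(1)]] in auto)
qed

text \<open>
  The double series over pairs \<open>(d, k)\<close> is rearranged according to the product \<open>n = d k\<close>.
\<close>

lemma has_sum_dirichlet_conv:
  assumes "dirichlet_term f s summable_on {1..}" "dirichlet_term g s summable_on {1..}"
  shows "(dirichlet_term (dirichlet_conv f g) s has_sum (dirichlet_series f s * dirichlet_series g s)) {1..}"
proof -
  have "((\<lambda>(x, y). dirichlet_term f s x * dirichlet_term g s y) has_sum
      (dirichlet_series f s * dirichlet_series g s)) ({1..} \<times> {1..})"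
    unfolding dirichlet_series_def by (rule has_sum_Times_mult[OF assms])
  moreover have "((\<lambda>(x, y). dirichlet_term f s x * dirichlet_term g s y) has_sum S) ({1..} \<times> {1..}) \<longleftrightarrow>
      ((\<lambda>(n, d). dirichlet_term f s d * dirichlet_term g s (n div d)) has_sum S) (Sigma {1..} (\<lambda>n. {d. d dvd n}))" for S
    by (rule has_sum_reindex_bij_witness[of _ "\<lambda>(n, d). (d, n div d)" "\<lambda>(d, k). (d * k, d)"])
       (auto simp: Suc_le_eq intro!: Nat.gr0I)
  ultimately have "((\<lambda>(n, d). dirichlet_term f s d * dirichlet_term g s (n div d)) has_sum
      (dirichlet_series f s * dirichlet_series g s)) (Sigma {1..} (\<lambda>n. {d. d dvd n}))"
    by blast
  then show ?thesis
  proof (rule has_sum_SigmaD)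
    fix n :: nat assume n: "n \<in> {1..}"
    have "dirichlet_term f s d * dirichlet_term g s (n div d)
        = of_nat (f d * g (n div d)) / of_nat n powr s" if d: "d dvd n" for d
    proof -
      obtain k where k: "n = d * k" using d by (elim dvdE)
      have "d > 0" "k > 0" using k n by (auto intro!: Nat.gr0I)
      moreover have "(of_nat (d * k) :: complex) powr s = of_nat d powr s * of_nat k powr s"
        using powr_times_real[of "of_nat d" "of_nat k" s] by simp
      ultimately show ?thesis by (simp add: dirichlet_term_def k)
    qed
    then have "(\<Sum>d | d dvd n. dirichlet_term f s d * dirichlet_term g s (n div d))
        = (\<Sum>d | d dvd n. of_nat (f d * g (n div d)) / of_nat n powr s)"
      by (intro sum.cong) auto
    also have "\<dots> = dirichlet_term (dirichlet_conv f g) s n"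
      by (simp add: dirichlet_term_def dirichlet_conv_def sum_divide_distrib)
    finally show "((\<lambda>d. case (n, d) of (n, d) \<Rightarrow> dirichlet_term f s d * dirichlet_term g s (n div d)) has_sum
        dirichlet_term (dirichlet_conv f g) s n) {d. d dvd n}"
      using n by (intro has_sum_finiteI) auto
  qed
qed

lemma norm_dirichlet_term:
  "n > 0 \<Longrightarrow> norm (dirichlet_term f s n) = real (f n) * real n powr (- Re s)"
  by (simp add: dirichlet_term_def norm_divide norm_mult norm_inverse norm_powr_real_powr powr_minus divide_inverse)

lemma summable_on_powr: "\<sigma> > 1 \<Longrightarrow> (\<lambda>n. real n powr (- \<sigma>)) summable_on {1..}"
proof -
  assume "\<sigma> > 1"
  then have "summable (\<lambda>n. norm (real n powr (- \<sigma>)))" using summable_real_powr_iff[of "-\<sigma>"] by simp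
  then have "(\<lambda>n. real n powr (- \<sigma>)) summable_on UNIV" by (rule norm_summable_imp_summable_on)
  then show ?thesis by (rule summable_on_subset) simp
qed

lemma dirichlet_term_summable:
  assumes "\<And>n. n > 0 \<Longrightarrow> real (f n) \<le> C * real n powr \<alpha>" "Re s > 1 + \<alpha>"
  shows "dirichlet_term f s summable_on {1..}"
proof (rule Infinite_Sum.abs_summable_summable, rule Infinite_Sum.abs_summable_on_comparison_test')
  show "(\<lambda>n. C * real n powr (- (Re s - \<alpha>))) summable_on {1..}"
    using assms(2) by (intro summable_on_cmult_right summable_on_powr) simp
  fix n :: nat assume n: "n \<in> {1..}"
  then have "norm (dirichlet_term f s n) \<le> C * real n powr \<alpha> * real n powr (- Re s)"
    using assms(1)[of n] by (simp add: norm_dirichlet_term mult_right_mono)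
  also have "\<dots> = C * real n powr (- (Re s - \<alpha>))" by (simp add: mult.assoc flip: powr_add)
  finally show "norm (dirichlet_term f s n) \<le> C * real n powr (- (Re s - \<alpha>))" .
qed

text \<open>
  Gauss' identity: the totients of the divisors of \<open>n\<close> add up to \<open>n\<close>.
\<close>

lemma dirichlet_series_totient:
  assumes "Re s > 2"
  shows "riemann_zeta s * dirichlet_series totient s = riemann_zeta (s - 1)"
proof -
  have "dirichlet_term (\<lambda>_. 1) s summable_on {1..}"
    by (rule dirichlet_term_summable[of _ 1 0]) (use assms in auto)
  moreover have "dirichlet_term totient s summable_on {1..}"
    by (rule dirichlet_term_summable[of _ 1 1]) (use assms totient_le in auto)
  ultimately have "(dirichlet_term (dirichlet_conv totient (\<lambda>_. 1)) s has_sum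
      (dirichlet_series totient s * dirichlet_series (\<lambda>_. 1) s)) {1..}"
    by (intro has_sum_dirichlet_conv)
  moreover have "dirichlet_term (dirichlet_conv totient (\<lambda>_. 1)) s n = dirichlet_term (\<lambda>_. 1) (s - 1) n"
    if "n \<in> {1..}" for n
    using that by (simp add: dirichlet_term_def dirichlet_conv_def totient_divisor_sum powr_diff)
  ultimately have "(dirichlet_term (\<lambda>_. 1) (s - 1) has_sum
      (dirichlet_series totient s * dirichlet_series (\<lambda>_. 1) s)) {1..}"
    using has_sum_cong[of "{1..}" "dirichlet_term (dirichlet_conv totient (\<lambda>_. 1)) s"
      "dirichlet_term (\<lambda>_. 1) (s - 1)"] by blast
  from infsumI[OF this] show ?thesis
    by (simp add: riemann_zeta_def dirichlet_series_def mult.commute)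
qed

text \<open>
  The tail \<open>\<Sum> n\<^sup>-\<^sup>s\<close> over \<open>n \<ge> 2\<close> is bounded by \<open>\<pi>\<^sup>2 / 6 - 1 < 1\<close>, so it cannot cancel the leading term \<open>1\<close>.
\<close>

lemma riemann_zeta_nonzero:
  assumes "Re s > 2"
  shows "riemann_zeta s \<noteq> 0"
proof -
  have sm: "dirichlet_term (\<lambda>_. 1) s summable_on {1..}"
    by (rule dirichlet_term_summable[of _ 1 0]) (use assms in auto)
  have split: "{1::nat..} = insert 1 {2..}" by auto
  have sm2: "dirichlet_term (\<lambda>_. 1) s summable_on {2..}" using sm by (rule summable_on_subset) auto
  have "riemann_zeta s = 1 + infsum (dirichlet_term (\<lambda>_. 1) s) {2..}"
    unfolding riemann_zeta_def dirichlet_series_def split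
    using sm2 by (subst infsum_insert) (auto simp: dirichlet_term_def)
  moreover have "norm (infsum (dirichlet_term (\<lambda>_. 1) s) {2..}) < 1"
  proof -
    have sums: "(\<lambda>n. 1 / (real (Suc n))\<^sup>2) sums (pi\<^sup>2 / 6)"
      using inverse_squares_sums by (simp add: add.commute)
    then have "((\<lambda>n. 1 / (real (Suc n))\<^sup>2) has_sum (pi\<^sup>2 / 6)) UNIV"
      by (intro norm_summable_imp_has_sum) (auto simp: sums_iff)
    also have "?this \<longleftrightarrow> ((\<lambda>n. 1 / (real n)\<^sup>2) has_sum (pi\<^sup>2 / 6)) {1..}"
      by (rule has_sum_reindex_bij_witness[of _ "\<lambda>n. n - 1" Suc]) auto
    finally have h1: "((\<lambda>n. 1 / (real n)\<^sup>2) has_sum (pi\<^sup>2 / 6)) {1..}" .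
    then have sq: "(\<lambda>n. 1 / (real n)\<^sup>2) summable_on {2..}"
      by (rule summable_on_subset[OF has_sum_imp_summable]) auto
    then have "((\<lambda>n. 1 / (real n)\<^sup>2) has_sum (1 + infsum (\<lambda>n. 1 / (real n)\<^sup>2) {2..})) {1..}"
      unfolding split using has_sum_insert[of 1 "{2..}", OF _ has_sum_infsum[OF sq]] by simp
    with h1 have v: "infsum (\<lambda>n. 1 / (real n)\<^sup>2) {2..} = pi\<^sup>2 / 6 - 1"
      using has_sum_unique by fastforce
    have "norm (infsum (dirichlet_term (\<lambda>_. 1) s) {2..}) \<le> infsum (\<lambda>n. 1 / (real n)\<^sup>2) {2..}"
    proof (rule norm_infsum_le)
      show "(dirichlet_term (\<lambda>_. 1) s has_sum infsum (dirichlet_term (\<lambda>_. 1) s) {2..}) {2..}"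
        using sm2 by (rule has_sum_infsum)
      show "((\<lambda>n. 1 / (real n)\<^sup>2) has_sum infsum (\<lambda>n. 1 / (real n)\<^sup>2) {2..}) {2..}"
        using sq by (rule has_sum_infsum)
      fix n :: nat assume n: "n \<in> {2..}"
      have "norm (dirichlet_term (\<lambda>_. 1) s n) = real n powr (- Re s)" using n by (simp add: norm_dirichlet_term)
      also have "\<dots> \<le> real n powr (- 2)" using n assms by (intro powr_mono) auto
      also have "\<dots> = 1 / (real n)\<^sup>2" using n by (simp add: powr_minus powr_numeral divide_inverse)
      finally show "norm (dirichlet_term (\<lambda>_. 1) s n) \<le> 1 / (real n)\<^sup>2" .
    qed
    moreover have "pi\<^sup>2 < (32 / 10)\<^sup>2" using pi_approx by (intro power_strict_mono) auto
    then have "pi\<^sup>2 / 6 - 1 < 1" by (simp add: power2_eq_square)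
    ultimately show ?thesis using v by linarith
  qed
  ultimately show ?thesis
    by (metis add.commute add_eq_0_iff norm_minus_cancel norm_one less_irrefl)
qed

lemma num_square_residues_le: "b > 0 \<Longrightarrow> num_square_residues b m \<le> b"
proof -
  assume "b > 0"
  then have "{d\<^sup>2 mod b | d. d dvd m \<and> coprime d b} \<subseteq> {..<b}" by auto
  then show ?thesis unfolding num_square_residues_def
    using card_mono[of "{..<b}"] by fastforce
qed

lemma summable_num_square_residues:
  assumes "b > 0" "Re s > 1"
  shows "dirichlet_term (num_square_residues b) s summable_on {1..}"
  by (rule dirichlet_term_summable[of _ "real b" 0]) (use assms num_square_residues_le in auto)

text \<open>
  Substituting \<open>m = e n\<close> turns the factor \<open>e\<^sup>-\<^sup>s\<close> into a shift of the coefficients.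
\<close>

lemma dirichlet_series_shift:
  assumes "dirichlet_term f s summable_on {1..}" "e > 0"
  shows "(dirichlet_term (\<lambda>m. if e dvd m then f (m div e) else 0) s has_sum
    (of_nat e powr (- s) * dirichlet_series f s)) {1..}"
proof -
  have "((\<lambda>n. of_nat e powr (- s) * dirichlet_term f s n) has_sum (of_nat e powr (- s) * dirichlet_series f s)) {1..}"
    unfolding dirichlet_series_def by (intro has_sum_cmult_right has_sum_infsum assms)
  also have "?this \<longleftrightarrow> (dirichlet_term (\<lambda>m. if e dvd m then f (m div e) else 0) s has_sum
    (of_nat e powr (- s) * dirichlet_series f s)) {m\<in>{1..}. e dvd m}"
  proof (rule has_sum_reindex_bij_witness[of _ "\<lambda>m. m div e" "\<lambda>n. e * n"])
    fix n :: nat assume n: "n \<in> {1..}"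
    have "(of_nat (e * n) :: complex) powr s = of_nat e powr s * of_nat n powr s"
      using powr_times_real[of "of_nat e" "of_nat n" s] by simp
    then show "dirichlet_term (\<lambda>m. if e dvd m then f (m div e) else 0) s (e * n) = of_nat e powr (- s) * dirichlet_term f s n"
      using assms(2) by (simp add: dirichlet_term_def powr_minus field_simps)
  qed (use assms(2) in \<open>auto simp: Suc_le_eq div_greater_zero_iff dvd_imp_le\<close>)
  also have "\<dots> \<longleftrightarrow> (dirichlet_term (\<lambda>m. if e dvd m then f (m div e) else 0) s has_sum
    (of_nat e powr (- s) * dirichlet_series f s)) {1..}"
    by (rule has_sum_cong_neutral) (auto simp: dirichlet_term_def)
  finally show ?thesis .
qed

lemma has_sum_finite_sum:
  fixes f :: "'i \<Rightarrow> 'a \<Rightarrow> 'b :: topological_comm_monoid_add"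
  assumes "finite I" "\<And>i. i \<in> I \<Longrightarrow> (f i has_sum S i) A"
  shows "((\<lambda>x. \<Sum>i\<in>I. f i x) has_sum (\<Sum>i\<in>I. S i)) A"
  using assms by (induction I rule: finite_induct) (auto intro!: has_sum_add has_sum_0)

text \<open>
  The summand for \<open>b\<close> is the convolution of the totient with the residue count, shifted by \<open>B / b\<close>. The quotient
  of zeta values is the Dirichlet series of the totient, since \<open>\<zeta>(s)\<close> does not vanish.
\<close>

lemma has_sum_divisor_formula:
  assumes "Re s > 2" "B > 0"
    and "\<And>m. m > 0 \<Longrightarrow> a m = (\<Sum>b | b dvd B. if B div b dvd m
      then \<Sum>n | n dvd m div (B div b). totient n * num_square_residues b (m div (B div b) div n) else 0)"
  shows "(dirichlet_term a s has_sum (riemann_zeta (s - 1) / riemann_zeta s *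
      (\<Sum>b | b dvd B. (of_nat B / of_nat b) powr (- s) * dirichlet_series (num_square_residues b) s))) {1..}"
proof -
  define h where "h b = dirichlet_conv totient (num_square_residues b)" for b
  define t where "t b m = (if B div b dvd m then h b (m div (B div b)) else 0)" for b m
  have sm_phi: "dirichlet_term totient s summable_on {1..}"
    by (rule dirichlet_term_summable[of _ 1 1]) (use assms totient_le in auto)
  have "(dirichlet_term (t b) s has_sum
      ((of_nat B / of_nat b) powr (- s) * (dirichlet_series totient s * dirichlet_series (num_square_residues b) s))) {1..}"
    if b: "b dvd B" for b
  proof -
    have b0: "b > 0" using b assms(2) by (auto intro: Nat.gr0I)
    have e0: "B div b > 0" using b assms(2) by (metis dvd_div_eq_0_iff neq0_conv)
    have hs: "(dirichlet_term (h b) s has_sum (dirichlet_series totient s * dirichlet_series (num_square_residues b) s)) {1..}"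
      unfolding h_def using sm_phi summable_num_square_residues[OF b0] assms(1) by (intro has_sum_dirichlet_conv) auto
    have "dirichlet_series (h b) s = dirichlet_series totient s * dirichlet_series (num_square_residues b) s"
      using infsumI[OF hs] by (simp add: dirichlet_series_def)
    moreover have "of_nat B / of_nat b = (of_nat (B div b) :: complex)" using b b0 by (auto elim: dvdE)
    ultimately show ?thesis
      using dirichlet_series_shift[OF has_sum_imp_summable[OF hs] e0] unfolding t_def by simp
  qed
  then have sum_t: "((\<lambda>m. \<Sum>b | b dvd B. dirichlet_term (t b) s m) has_sum
      (\<Sum>b | b dvd B. (of_nat B / of_nat b) powr (- s) * (dirichlet_series totient s * dirichlet_series (num_square_residues b) s))) {1..}"
    using assms(2) by (intro has_sum_finite_sum) auto
  have coeff: "(\<Sum>b | b dvd B. dirichlet_term (t b) s m) = dirichlet_term a s m" if "m \<in> {1..}" for m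
  proof -
    have "a m = (\<Sum>b | b dvd B. t b m)"
      using that assms(3)[of m] unfolding t_def h_def dirichlet_conv_def by simp
    then show ?thesis by (simp add: dirichlet_term_def sum_divide_distrib)
  qed
  have "(dirichlet_term a s has_sum
      (\<Sum>b | b dvd B. (of_nat B / of_nat b) powr (- s) * (dirichlet_series totient s * dirichlet_series (num_square_residues b) s))) {1..}"
    by (rule has_sum_cong[THEN iffD1, OF coeff sum_t])
  moreover have "dirichlet_series totient s = riemann_zeta (s - 1) / riemann_zeta s"
    unfolding dirichlet_series_totient[OF assms(1), symmetric] using riemann_zeta_nonzero[OF assms(1)] by simp
  ultimately show ?thesis
    unfolding sum_distrib_left by (simp only: mult.left_commute)
qed

section \<open>The zeta function of proper isometry classes\<close>

theorem theorem1p1: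
  fixes L :: "(rat ^ 2) set" and B :: nat and s :: complex
  assumes "sublattice L hyperbolic"
    and "B > 0"
    and "{of_nat B * of_int k | k. True} =
      {of_nat (lattice_index hyperbolic L) * q | q. q \<in> frac_ideal_inverse (norm_ideal L)}"
    and "Re s > 2"
  shows "dirichlet_term (num_proper_classes L) s summable_on {1..} \<and>
    (\<forall>b. b dvd B \<longrightarrow> dirichlet_term (num_square_residues b) s summable_on {1..}) \<and>
    zeta_SL L s = riemann_zeta (s - 1) / riemann_zeta s *
      (\<Sum>b | b dvd B. (of_nat B / of_nat b) powr (- s) *
        dirichlet_series (num_square_residues b) s)"
proof -
  have hyp: "sublattice L (lat 1 0 1)" using assms(1) by (simp only: hyperbolic_eq_lat)
  have one: "(0::rat) < 1" by simp
  obtain a' c' d' where L': "a' > 0" "d' > 0"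
    "L = lat (1 * of_int a') (1 * of_int c' + 0 * of_int d') (1 * of_int d')"
    using sublattice_normal_form[OF one one hyp] by blast
  define a c d :: rat where "a = of_int a'" and "c = of_int c'" and "d = of_int d'"
  have L: "L = lat a c d" using L'(3) by (simp add: a_def c_def d_def)
  have pos: "a > 0" "d > 0" using L' by (simp_all add: a_def d_def)
  have "lattice_index hyperbolic L = nat (a' * d')"
    unfolding hyperbolic_eq_lat L'(3) by (rule sublattice_sublat(2)[OF one one L'(1,2)])
  then have "of_nat (lattice_index hyperbolic L) = a * d"
    using L'(1,2) by (simp add: a_def d_def)
  then have order: "order_mod_Ints (c / a) B"
    using order_mod_Ints_from_norm_ideal[OF pos] assms(3) unfolding L by blast
  have count: "num_proper_classes L m = (\<Sum>b | b dvd B. if B div b dvd m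
      then \<Sum>n | n dvd m div (B div b). totient n * num_square_residues b (m div (B div b) div n) else 0)"
    if "m > 0" for m
    unfolding L num_proper_classes_lat[OF pos that] by (rule card_slopes_total[OF order that])
  note sum = has_sum_divisor_formula[of s B "num_proper_classes L", OF assms(4,2) count]
  show ?thesis
  proof (intro conjI allI impI)
    show "dirichlet_term (num_proper_classes L) s summable_on {1..}" using sum by (rule has_sum_imp_summable)
    show "dirichlet_term (num_square_residues b) s summable_on {1..}" if "b dvd B" for b
      using that assms(2,4) by (intro summable_num_square_residues) (auto intro: Nat.gr0I)
    show "zeta_SL L s = riemann_zeta (s - 1) / riemann_zeta s *
      (\<Sum>b | b dvd B. (of_nat B / of_nat b) powr (- s) * dirichlet_series (num_square_residues b) s)"
      unfolding zeta_SL_def dirichlet_series_def[of "num_proper_classes L"] using sum by (rule infsumI)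
  qed
qed

end
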